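(* Let $\mathcal M=(M,<,0,+,\ldots)$ be a definably complete locally o-minimal expansion of an ordered group having definable bounded multiplication $\cdot$ compatible to $+$. Then every regular definably compact pseudo-definable space $X$ is definably imbeddable into some $M^n$; that is, there exist $n$ and a definable map $h:X\to M^n$ which is a homeomorphism onto its image.
   Context: "Definable" for subsets of $M^n$ means definable in $\mathcal M$ with parameters; $M$ has the order topology, $M^n$ the product topology, and subsets of $M^n$ the relative topology. An open interval is $(a,b)=\{x\in M: a<x<b\}$, $a<b$ in $M$. Locally o-minimal: for every definable $X\subseteq M$ and $a\in M$ there is an open interval $I\ni a$ such that $X\cap I$ is a finite union of points and open intervals. Definably complete: every definable subset of $M$ has a supremum and an infimum in $M\cup\{\pm\infty\}$. An expansion $\mathcal M=(M,<,0,+,\ldots)$ of a densely linearly ordered group has definable bounded multiplication compatible to $+$ if there exist $1\in M$ and a map $\cdot:M\times M\to M$ such that (1) $(M,<,0,1,+,\cdot)$ is an ordered field, and (2) for every bounded open interval $I$, the restriction $\cdot|_{I\times I}$ is definable in $\mathcal M$. A pseudo-definable space is a pair $(S,\{\varphi_i:U_i\to U_i'\}_{i\in I})$ of a topological space $S$ and a finite family of homeomorphisms (a definable atlas) such that: $\{U_i\}_{i\in I}$ is a finite open cover of $S$; each $U_i'$ is a definable subset of some $M^{m_i}$; and for all $i\ne j$ with $U_i\cap U_j\ne\emptyset$, the composition $(\varphi_j|_{U_i\cap U_j})\circ(\varphi_i|_{U_i\cap U_j})^{-1}:\varphi_i(U_i\cap U_j)\to\varphi_j(U_i\cap U_j)$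 is a definable homeomorphism. A subset $X\subseteq S$ is definable if $\varphi_i(X\cap U_i)$ is definable for all $i\in I$. The product of two pseudo-definable spaces is the product space with the product charts. A map between pseudo-definable spaces is definable if its graph is definable in the product. A definable subset of $M^n$ is naturally a pseudo-definable space. A family $\mathcal F$ of subsets of a set is a filtered collection if for any $B_1,B_2\in\mathcal F$ there is $B_3\in\mathcal F$ with $B_3\subseteq B_1\cap B_2$. For pseudo-definable spaces $X,T$, a family $\{S_t\}_{t\in T}$ of definable subsets of $X$ is definable if $\bigcup_{t\in T}\{t\}\times S_t$ is definable in $T\times X$; it is a definable filtered collection if it is both definable and a filtered collection. $X$ is definably compact if every definable filtered collection of closed nonempty subsets of $X$ has nonempty intersection. Regular means regular as a topological space. *)

theory Defs
  imports
    "HOL-Analysis.Analysis"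
    "HOL-Algebra.Ring"
    "HOL-Library.Extended"
    "HOL-Library.Lub_Glb"
begin

section \<open>First-order expansions of ordered groups and definable sets\<close>

text \<open>
  The symbols \<open><\<close>, \<open>0\<close>, \<open>+\<close> are built into the syntax and always get the meaning they have in
  the class of the carrier type. The types \<open>'f\<close> and \<open>'r\<close> name the additional symbols, and a name
  used with \<open>k\<close> arguments stands for a \<open>k\<close>-ary symbol, so that no separate arity discipline
  is needed. An expansion is given by the interpretation of the additional symbols.
\<close>

datatype 'f fo_term =
    Var nat
  | Zero
  | Plus "'f fo_term" "'f fo_term"
  | Fun 'f "'f fo_term list"

datatype ('f, 'r) fo_form =
    Eq "'f fo_term" "'f fo_term"
  | Less "'f fo_term" "'f fo_term"
  | Rel 'r "'f fo_term list"
  | Neg "('f, 'r) fo_form"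
  | Conj "('f, 'r) fo_form" "('f, 'r) fo_form"
  | Exi nat "('f, 'r) fo_form"

record ('f, 'r, 'a) expansion =
  fun_interp :: "'f \<Rightarrow> 'a list \<Rightarrow> 'a"
  rel_interp :: "'r \<Rightarrow> 'a list \<Rightarrow> bool"

primrec val ::
    "('f, 'r, 'a::linordered_ab_group_add) expansion \<Rightarrow> (nat \<Rightarrow> 'a) \<Rightarrow> 'f fo_term \<Rightarrow> 'a" where
  "val M e (Var i) = e i"
| "val M e Zero = 0"
| "val M e (Plus s t) = val M e s + val M e t"
| "val M e (Fun f ts) = fun_interp M f (map (val M e) ts)"

primrec sat ::
    "('f, 'r, 'a::linordered_ab_group_add) expansion \<Rightarrow> (nat \<Rightarrow> 'a) \<Rightarrow> ('f, 'r) fo_form \<Rightarrow> bool" where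
  "sat M e (Eq s t) \<longleftrightarrow> val M e s = val M e t"
| "sat M e (Less s t) \<longleftrightarrow> val M e s < val M e t"
| "sat M e (Rel r ts) \<longleftrightarrow> rel_interp M r (map (val M e) ts)"
| "sat M e (Neg p) \<longleftrightarrow> \<not> sat M e p"
| "sat M e (Conj p q) \<longleftrightarrow> sat M e p \<and> sat M e q"
| "sat M e (Exi i p) \<longleftrightarrow> (\<exists>a. sat M (e(i := a)) p)"

text \<open>
  Points of \<open>M\<^sup>n\<close> are the extensional functions on \<open>{..<n}\<close>. On a type of class
  \<open>linorder_topology\<close>, \<open>euclidean\<close> is the order topology.
\<close>

definition Mpow :: "nat \<Rightarrow> (nat \<Rightarrow> 'a) set" where
  "Mpow n = {..<n} \<rightarrow>\<^sub>E UNIV"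

definition Mpow_top :: "nat \<Rightarrow> (nat \<Rightarrow> 'a::linorder_topology) topology" where
  "Mpow_top n = product_topology (\<lambda>_. euclidean) {..<n}"

definition concat_pt :: "nat \<Rightarrow> nat \<Rightarrow> (nat \<Rightarrow> 'a) \<Rightarrow> (nat \<Rightarrow> 'a) \<Rightarrow> (nat \<Rightarrow> 'a)" where
  "concat_pt m n x y = (\<lambda>i\<in>{..<m + n}. if i < m then x i else y (i - m))"

text \<open>
  Definability with parameters: the free variables with index below \<open>n\<close> range over the coordinates
  of the point, and \<open>p\<close> assigns the parameters to the remaining free variables.
\<close>

definition definable ::
    "('f, 'r, 'a::linordered_ab_group_add) expansion \<Rightarrow> nat \<Rightarrow> (nat \<Rightarrow> 'a) set \<Rightarrow> bool" where
  "definable M n X \<longleftrightarrow>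
     (\<exists>\<phi> p. X = {x \<in> Mpow n. sat M (\<lambda>i. if i < n then x i else p i) \<phi>})"

definition definable1 ::
    "('f, 'r, 'a::linordered_ab_group_add) expansion \<Rightarrow> 'a set \<Rightarrow> bool" where
  "definable1 M X \<longleftrightarrow> definable M 1 {x \<in> Mpow 1. x 0 \<in> X}"

definition locally_o_minimal ::
    "('f, 'r, 'a::linordered_ab_group_add) expansion \<Rightarrow> bool" where
  "locally_o_minimal M \<longleftrightarrow>
     (\<forall>X a. definable1 M X \<longrightarrow>
        (\<exists>c d \<C>. a \<in> {c<..<d} \<and> finite \<C> \<and>
           (\<forall>C\<in>\<C>. (\<exists>x. C = {x}) \<or> (\<exists>u v. u < v \<and> C = {u<..<v})) \<and>
           X \<inter> {c<..<d} = \<Union>\<C>))"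

definition definably_complete ::
    "('f, 'r, 'a::linordered_ab_group_add) expansion \<Rightarrow> bool" where
  "definably_complete M \<longleftrightarrow>
     (\<forall>X. definable1 M X \<longrightarrow>
        (\<exists>s::'a extended. isLub UNIV (Fin ` X) s) \<and>
        (\<exists>s::'a extended. isGlb UNIV (Fin ` X) s))"

text \<open>
  Compatibility of \<open><\<close> with \<open>+\<close> is part of the class of the carrier type.
\<close>

definition ordered_field_mult ::
    "'a::linordered_ab_group_add \<Rightarrow> ('a \<Rightarrow> 'a \<Rightarrow> 'a) \<Rightarrow> bool" where
  "ordered_field_mult e m \<longleftrightarrow>
     field \<lparr>carrier = UNIV, monoid.mult = m, one = e, zero = 0, add = (+)\<rparr> \<and>
     (\<forall>x y. 0 < x \<longrightarrow> 0 < y \<longrightarrow> 0 < m x y)"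

definition has_definable_bounded_mult ::
    "('f, 'r, 'a::linordered_ab_group_add) expansion \<Rightarrow> bool" where
  "has_definable_bounded_mult M \<longleftrightarrow>
     (\<exists>e m. ordered_field_mult e m \<and>
        (\<forall>a b. a < b \<longrightarrow>
           definable M 3 {x \<in> Mpow 3. x 0 \<in> {a<..<b} \<and> x 1 \<in> {a<..<b} \<and> x 2 = m (x 0) (x 1)}))"

definition definable_homeomorphism ::
    "('f, 'r, 'a::{linordered_ab_group_add, linorder_topology}) expansion \<Rightarrow>
     nat \<Rightarrow> (nat \<Rightarrow> 'a) set \<Rightarrow> nat \<Rightarrow> (nat \<Rightarrow> 'a) set \<Rightarrow> ((nat \<Rightarrow> 'a) \<Rightarrow> (nat \<Rightarrow> 'a)) \<Rightarrow> bool" where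
  "definable_homeomorphism M m A n B f \<longleftrightarrow>
     definable M m A \<and> definable M n B \<and>
     definable M (m + n) ((\<lambda>x. concat_pt m n x (f x)) ` A) \<and>
     homeomorphic_map (subtopology (Mpow_top m) A) (subtopology (Mpow_top n) B) f"


section \<open>Pseudo-definable spaces\<close>

text \<open>
  The targets of the charts are not recorded separately: the target of chart \<open>i\<close> is
  \<open>chart X i ` chart_dom X i\<close>, a subset of \<open>M\<close> to the power \<open>chart_dim X i\<close>.
\<close>

record ('s, 'i, 'a) atlas_space =
  space_top :: "'s topology"
  chart_idx :: "'i set"
  chart_dom :: "'i \<Rightarrow> 's set"
  chart_dim :: "'i \<Rightarrow> nat"
  chart :: "'i \<Rightarrow> 's \<Rightarrow> (nat \<Rightarrow> 'a)"

definition pseudo_definable_space ::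
    "('f, 'r, 'a::{linordered_ab_group_add, linorder_topology}) expansion \<Rightarrow>
     ('s, 'i, 'a) atlas_space \<Rightarrow> bool" where
  "pseudo_definable_space M X \<longleftrightarrow>
     finite (chart_idx X) \<and>
     (\<forall>i\<in>chart_idx X. openin (space_top X) (chart_dom X i)) \<and>
     (\<Union>i\<in>chart_idx X. chart_dom X i) = topspace (space_top X) \<and>
     (\<forall>i\<in>chart_idx X.
        definable M (chart_dim X i) (chart X i ` chart_dom X i) \<and>
        homeomorphic_map (subtopology (space_top X) (chart_dom X i))
          (subtopology (Mpow_top (chart_dim X i)) (chart X i ` chart_dom X i)) (chart X i)) \<and>
     (\<forall>i\<in>chart_idx X. \<forall>j\<in>chart_idx X.
        i \<noteq> j \<longrightarrow> chart_dom X i \<inter> chart_dom X j \<noteq> {} \<longrightarrow>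
        definable_homeomorphism M
          (chart_dim X i) (chart X i ` (chart_dom X i \<inter> chart_dom X j))
          (chart_dim X j) (chart X j ` (chart_dom X i \<inter> chart_dom X j))
          (chart X j \<circ> inv_into (chart_dom X i \<inter> chart_dom X j) (chart X i)))"

definition definable_in ::
    "('f, 'r, 'a::{linordered_ab_group_add, linorder_topology}) expansion \<Rightarrow>
     ('s, 'i, 'a) atlas_space \<Rightarrow> 's set \<Rightarrow> bool" where
  "definable_in M X A \<longleftrightarrow>
     A \<subseteq> topspace (space_top X) \<and>
     (\<forall>i\<in>chart_idx X. definable M (chart_dim X i) (chart X i ` (A \<inter> chart_dom X i)))"

definition prod_space ::
    "('s, 'i, 'a) atlas_space \<Rightarrow> ('t, 'j, 'a) atlas_space \<Rightarrow> ('s \<times> 't, 'i \<times> 'j, 'a) atlas_space" where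
  "prod_space X Y =
     \<lparr>space_top = prod_topology (space_top X) (space_top Y),
      chart_idx = chart_idx X \<times> chart_idx Y,
      chart_dom = (\<lambda>(i, j). chart_dom X i \<times> chart_dom Y j),
      chart_dim = (\<lambda>(i, j). chart_dim X i + chart_dim Y j),
      chart = (\<lambda>(i, j) (x, y). concat_pt (chart_dim X i) (chart_dim Y j) (chart X i x) (chart Y j y))\<rparr>"

definition Mpow_space :: "nat \<Rightarrow> (nat \<Rightarrow> 'a::linorder_topology, unit, 'a) atlas_space" where
  "Mpow_space n =
     \<lparr>space_top = Mpow_top n, chart_idx = {()}, chart_dom = (\<lambda>_. Mpow n),
      chart_dim = (\<lambda>_. n), chart = (\<lambda>_ x. x)\<rparr>"

definition definable_map ::
    "('f, 'r, 'a::{linordered_ab_group_add, linorder_topology}) expansion \<Rightarrow>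
     ('s, 'i, 'a) atlas_space \<Rightarrow> ('t, 'j, 'a) atlas_space \<Rightarrow> ('s \<Rightarrow> 't) \<Rightarrow> bool" where
  "definable_map M X Y f \<longleftrightarrow>
     f \<in> topspace (space_top X) \<rightarrow> topspace (space_top Y) \<and>
     definable_in M (prod_space X Y) ((\<lambda>x. (x, f x)) ` topspace (space_top X))"

definition filtered_collection :: "'s set set \<Rightarrow> bool" where
  "filtered_collection \<F> \<longleftrightarrow> (\<forall>B1\<in>\<F>. \<forall>B2\<in>\<F>. \<exists>B3\<in>\<F>. B3 \<subseteq> B1 \<inter> B2)"

definition definable_family ::
    "('f, 'r, 'a::{linordered_ab_group_add, linorder_topology}) expansion \<Rightarrow>
     ('t, 'j, 'a) atlas_space \<Rightarrow> ('s, 'i, 'a) atlas_space \<Rightarrow> ('t \<Rightarrow> 's set) \<Rightarrow> bool" where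
  "definable_family M T X S \<longleftrightarrow>
     (\<forall>t\<in>topspace (space_top T). definable_in M X (S t)) \<and>
     definable_in M (prod_space T X) (SIGMA t:topspace (space_top T). S t)"

definition definable_filtered_collection ::
    "('f, 'r, 'a::{linordered_ab_group_add, linorder_topology}) expansion \<Rightarrow>
     ('t, 'j, 'a) atlas_space \<Rightarrow> ('s, 'i, 'a) atlas_space \<Rightarrow> ('t \<Rightarrow> 's set) \<Rightarrow> bool" where
  "definable_filtered_collection M T X S \<longleftrightarrow>
     definable_family M T X S \<and> filtered_collection (S ` topspace (space_top T))"

text \<open>
  The parameter space \<open>T\<close> is an arbitrary pseudo-definable space. A definition cannot quantify over
  types, but fixing the type of points of \<open>T\<close> to \<open>nat \<times> (nat \<Rightarrow> 'a)\<close> and the type of chart indices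
  to \<open>nat\<close> loses nothing: number the finitely many charts and send a point to the pair of the number
  of some chart around it and its image under that chart. This injects any pseudo-definable space
  into the type, and transporting the topology and the atlas gives an isomorphic copy.
  If \<open>T\<close> is empty, the intersection below is \<open>UNIV\<close>, so the empty family imposes no condition.
\<close>

definition definably_compact ::
    "('f, 'r, 'a::{linordered_ab_group_add, linorder_topology}) expansion \<Rightarrow>
     ('s, 'i, 'a) atlas_space \<Rightarrow> bool" where
  "definably_compact M X \<longleftrightarrow>
     (\<forall>(T :: (nat \<times> (nat \<Rightarrow> 'a), nat, 'a) atlas_space) S.
        pseudo_definable_space M T \<longrightarrow>
        definable_filtered_collection M T X S \<longrightarrow>
        (\<forall>t\<in>topspace (space_top T). closedin (space_top X) (S t) \<and> S t \<noteq> {}) \<longrightarrow>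
        (\<Inter>t\<in>topspace (space_top T). S t) \<noteq> {})"

end

theory Submission
  imports Defs
begin

text \<open>
  By regularity, every point \<open>x\<close> of a chart has a closed coordinate box around it that is closed in the
  whole space. Definable compactness, applied to the closures of the sets of points that have no such
  box of radius \<open>r\<close> with centre bounded by \<open>K\<close>, yields \<open>r\<close> and \<open>K\<close> that work for
  all points, each with a suitable chart. For each chart let \<open>\<lambda>\<^sub>i y\<close> be the supremum of the radii
  \<open>s \<le> r\<close> such that the box of radius \<open>s\<close> around \<open>y\<close> is closed in the space and contained in a fixed
  large cube, and \<open>0\<close> outside the chart. It is 1-Lipschitz on the chart, and definable completeness
  makes it continuous at the points outside. Scaling \<open>\<lambda>\<^sub>i\<close> by bounded multiplication gives \<open>\<mu>\<^sub>i\<close> with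
  value \<open>3 K\<close> wherever \<open>\<lambda>\<^sub>i = r\<close>. The chart coordinates clamped to \<open>[- \<mu>\<^sub>i, \<mu>\<^sub>i]\<close> are then continuous on
  the whole space, and together with the \<open>\<mu>\<^sub>i\<close> they form the embedding: the open condition
  \<open>2 K < \<mu>\<^sub>i\<close> together with clamped coordinates strictly between \<open>- 2 K\<close> and \<open>2 K\<close> recovers the
  coordinates of chart \<open>i\<close>.
\<close>

section \<open>Renaming variables in formulas\<close>

text \<open>Closed boxes of \<open>M\<^sup>n\<close> need not be compact and M need not be
  archimedean, so every limit argument has to be a first-order statement about a definable family.
  Closure and closedness are therefore restated with quantifiers over points and radii, and
  definability is tracked by closure rules for HOL predicates (\<open>def_pred\<close>) and
  functions (\<open>def_term\<close>) instead of explicit formulas. Chart coordinates need not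
  extend continuously beyond their chart; clamping them by a bound that tends to 0 at the edge
  repairs this. The natural bound is a radius, hence at most r, while the coordinates to be
  preserved reach K, and no integer multiple of r need exceed K. This is why the radius is
  multiplied by 3 K / r, a product of bounded factors. The gaps between K, 2 K and 3 K turn the weak
  estimates at a covered point into strict ones, which cut out an open set. The large cube in the
  definition of \<open>\<lambda>\<^sub>i\<close> keeps coordinates bounded, so that suprema exist
  when a limit outside the chart is examined.\<close>

lemma map_val_finite_support:
  fixes M :: "('f, 'r, 'a::linordered_ab_group_add) expansion"
  shows "\<exists>N. \<forall>e e'. (\<forall>i<N. e i = e' i) \<longrightarrow> map (val M e) ts = map (val M e') ts"
proof -
  have *: "\<exists>N. \<forall>e e'. (\<forall>i<N. e i = e' i) \<longrightarrow> val M e t = val M e' t" for t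
  proof (induction t)
    case (Var i)
    then show ?case by (intro exI[of _ "Suc i"]) simp
  next
    case Zero
    then show ?case by simp
  next
    case (Plus s t)
    then obtain N1 N2 where
      1: "\<forall>e e'. (\<forall>i<N1. e i = e' i) \<longrightarrow> val M e s = val M e' s" and
      2: "\<forall>e e'. (\<forall>i<N2. e i = e' i) \<longrightarrow> val M e t = val M e' t" by blast
    show ?case
    proof (intro exI[of _ "max N1 N2"] allI impI)
      fix e e' :: "nat \<Rightarrow> 'a" assume "\<forall>i < max N1 N2. e i = e' i"
      then have "val M e s = val M e' s" "val M e t = val M e' t"
        using 1[rule_format, of e e'] 2[rule_format, of e e'] by simp_all
      then show "val M e (Plus s t) = val M e' (Plus s t)" by simp
    qed
  next
    case (Fun f ts)
    then obtain N where N: "\<forall>t\<in>set ts. \<forall>e e'. (\<forall>i<N t. e i = e' i) \<longrightarrow> val M e t = val M e' t"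
      by metis
    show ?case
    proof (intro exI allI impI)
      fix e e' :: "nat \<Rightarrow> 'a" assume *: "\<forall>i < Max (insert 0 (N ` set ts)). e i = e' i"
      have "val M e t = val M e' t" if "t \<in> set ts" for t
      proof -
        have "N t \<le> Max (insert 0 (N ` set ts))" using that by (intro Max_ge) auto
        then show ?thesis using N that * by (meson order_less_le_trans)
      qed
      then have "map (val M e) ts = map (val M e') ts" by simp
      then show "val M e (Fun f ts) = val M e' (Fun f ts)" by (simp only: val.simps)
    qed
  qed
  show ?thesis
  proof (induction ts)
    case (Cons t ts)
    obtain N1 where 1: "\<forall>e e'. (\<forall>i<N1. e i = e' i) \<longrightarrow> val M e t = val M e' t"
      using * by blast
    obtain N2 where 2: "\<forall>e e'. (\<forall>i<N2. e i = e' i) \<longrightarrow> map (val M e) ts = map (val M e') ts"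
      using Cons.IH by blast
    show ?case
    proof (intro exI[of _ "max N1 N2"] allI impI)
      fix e e' :: "nat \<Rightarrow> 'a" assume "\<forall>i < max N1 N2. e i = e' i"
      then have "val M e t = val M e' t" "map (val M e) ts = map (val M e') ts"
        using 1[rule_format, of e e'] 2[rule_format, of e e'] by simp_all
      then show "map (val M e) (t # ts) = map (val M e') (t # ts)" by simp
    qed
  qed simp
qed

text \<open>An assignment covers infinitely many variables, but a formula reads only finitely many.
  This supplies fresh variables and reduces quantification over a whole vector to finitely many
  quantifiers.\<close>

lemma sat_finite_support:
  fixes M :: "('f, 'r, 'a::linordered_ab_group_add) expansion"
  shows "\<exists>N. \<forall>e e'. (\<forall>i<N. e i = e' i) \<longrightarrow> sat M e \<psi> = sat M e' \<psi>"
proof (induction \<psi>)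
  case (Eq s t)
  obtain N where N: "\<forall>e e'. (\<forall>i<N. e i = e' i) \<longrightarrow> map (val M e) [s, t] = map (val M e') [s, t]"
    using map_val_finite_support by blast
  show ?case
  proof (intro exI[of _ N] allI impI)
    fix e e' :: "nat \<Rightarrow> 'a" assume "\<forall>i<N. e i = e' i"
    then show "sat M e (Eq s t) = sat M e' (Eq s t)" using N[rule_format, of e e'] by simp
  qed
next
  case (Less s t)
  obtain N where N: "\<forall>e e'. (\<forall>i<N. e i = e' i) \<longrightarrow> map (val M e) [s, t] = map (val M e') [s, t]"
    using map_val_finite_support by blast
  show ?case
  proof (intro exI[of _ N] allI impI)
    fix e e' :: "nat \<Rightarrow> 'a" assume "\<forall>i<N. e i = e' i"
    then show "sat M e (Less s t) = sat M e' (Less s t)" using N[rule_format, of e e'] by simp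
  qed
next
  case (Rel r ts)
  obtain N where N: "\<forall>e e'. (\<forall>i<N. e i = e' i) \<longrightarrow> map (val M e) ts = map (val M e') ts"
    using map_val_finite_support by blast
  show ?case
  proof (intro exI[of _ N] allI impI)
    fix e e' :: "nat \<Rightarrow> 'a" assume "\<forall>i<N. e i = e' i"
    then show "sat M e (Rel r ts) = sat M e' (Rel r ts)"
      using N[rule_format, of e e'] by (simp only: sat.simps)
  qed
next
  case (Neg p)
  then show ?case by simp
next
  case (Conj p q)
  then obtain N1 N2 where
    1: "\<forall>e e'. (\<forall>i<N1. e i = e' i) \<longrightarrow> sat M e p = sat M e' p" and
    2: "\<forall>e e'. (\<forall>i<N2. e i = e' i) \<longrightarrow> sat M e q = sat M e' q" by blast
  show ?case
  proof (intro exI[of _ "max N1 N2"] allI impI)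
    fix e e' :: "nat \<Rightarrow> 'a" assume "\<forall>i < max N1 N2. e i = e' i"
    then show "sat M e (Conj p q) = sat M e' (Conj p q)"
      using 1[rule_format, of e e'] 2[rule_format, of e e'] by simp
  qed
next
  case (Exi i p)
  then obtain N where N: "\<forall>e e'. (\<forall>i<N. e i = e' i) \<longrightarrow> sat M e p = sat M e' p" by blast
  show ?case
  proof (intro exI[of _ N] allI impI)
    fix e e' :: "nat \<Rightarrow> 'a" assume "\<forall>i<N. e i = e' i"
    then have "sat M (e(i := a)) p = sat M (e'(i := a)) p" for a
      by (intro N[rule_format]) simp
    then show "sat M e (Exi i p) = sat M e' (Exi i p)" by simp
  qed
qed

primrec rename_term :: "(nat \<Rightarrow> nat) \<Rightarrow> 'f fo_term \<Rightarrow> 'f fo_term" where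
  "rename_term \<sigma> (Var i) = Var (\<sigma> i)"
| "rename_term \<sigma> Zero = Zero"
| "rename_term \<sigma> (Plus s t) = Plus (rename_term \<sigma> s) (rename_term \<sigma> t)"
| "rename_term \<sigma> (Fun f ts) = Fun f (map (rename_term \<sigma>) ts)"

lemma val_rename_term: "val M e (rename_term \<sigma> t) = val M (e \<circ> \<sigma>) t"
proof (induction t)
  case (Fun f ts)
  then have "map (val M e \<circ> rename_term \<sigma>) ts = map (val M (e \<circ> \<sigma>)) ts"
    unfolding map_eq_conv comp_apply[of "val M e"] by blast
  then show ?case by (simp only: val.simps rename_term.simps map_map)
qed simp_all

text \<open>\<open>\<sigma>\<close> need not be injective: the bound variables are chosen afresh.\<close>

lemma ex_sat_rename:
  "\<exists>\<psi>'. \<forall>e. sat M e \<psi>' = sat M (e \<circ> \<sigma>) \<psi>"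
proof (induction \<psi> arbitrary: \<sigma>)
  case (Eq s t)
  then show ?case by (intro exI[of _ "Eq (rename_term \<sigma> s) (rename_term \<sigma> t)"]) (simp only: sat.simps val_rename_term simp_thms)
next
  case (Less s t)
  then show ?case by (intro exI[of _ "Less (rename_term \<sigma> s) (rename_term \<sigma> t)"]) (simp only: sat.simps val_rename_term simp_thms)
next
  case (Rel r ts)
  have "val M e \<circ> rename_term \<sigma> = val M (e \<circ> \<sigma>)" for e
    by (rule ext) (simp only: comp_apply[of "val M e"] val_rename_term)
  then show ?case by (intro exI[of _ "Rel r (map (rename_term \<sigma>) ts)"]) (simp only: sat.simps map_map simp_thms)
next
  case (Neg p)
  then show ?case by (metis sat.simps(4))
next
  case (Conj p q)
  then show ?case by (metis sat.simps(5))
next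
  case (Exi i p)
  obtain N where N: "\<forall>e e'. (\<forall>i<N. e i = e' i) \<longrightarrow> sat M e p = sat M e' p"
    using sat_finite_support by blast
  \<comment> \<open>\<open>z\<close> lies above every variable that \<open>p\<close> can read after
    renaming by \<open>\<sigma>\<close>, so rebinding it captures nothing.\<close>
  define z where "z = Suc (Max (insert 0 (\<sigma> ` {..<N})))"
  have z: "\<sigma> j < z" if "j < N" for j
    unfolding z_def less_Suc_eq_le using that by (intro Max_ge) auto
  obtain p' where p': "\<forall>e. sat M e p' = sat M (e \<circ> \<sigma>(i := z)) p" using Exi by blast
  have "sat M (e(z := a) \<circ> \<sigma>(i := z)) p = sat M ((e \<circ> \<sigma>)(i := a)) p" for e a
    using z by (intro N[rule_format]) fastforce
  then have "\<forall>e. sat M e (Exi z p') = sat M (e \<circ> \<sigma>) (Exi i p)" using p' by simp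
  then show ?case by blast
qed

lemma ex_sat_exi_finite:
  assumes "finite S"
  shows "\<exists>\<psi>'. \<forall>e. sat M e \<psi>' \<longleftrightarrow> (\<exists>x. sat M (\<lambda>i. if i \<in> S then x i else e i) \<psi>)"
  using assms
proof (induction S)
  case empty
  then show ?case by auto
next
  case (insert s S)
  then obtain \<psi>' where \<psi>': "\<And>e. sat M e \<psi>' \<longleftrightarrow> (\<exists>x. sat M (\<lambda>i. if i \<in> S then x i else e i) \<psi>)" by blast
  have "sat M e (Exi s \<psi>') \<longleftrightarrow> (\<exists>x. sat M (\<lambda>i. if i \<in> insert s S then x i else e i) \<psi>)" (is "?l \<longleftrightarrow> ?r") for e
  proof
    assume ?l
    then obtain a where "sat M (e(s := a)) \<psi>'" by auto
    then obtain x where "sat M (\<lambda>i. if i \<in> S then x i else (e(s := a)) i) \<psi>" using \<psi>' by blast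
    also have "(\<lambda>i. if i \<in> S then x i else (e(s := a)) i)
       = (\<lambda>i. if i \<in> insert s S then (x(s := a)) i else e i)" using insert by auto
    finally show ?r by blast
  next
    assume ?r
    then obtain x where "sat M (\<lambda>i. if i \<in> insert s S then x i else e i) \<psi>" by blast
    also have "(\<lambda>i. if i \<in> insert s S then x i else e i)
        = (\<lambda>i. if i \<in> S then x i else (e(s := x s)) i)" by auto
    finally have "sat M (e(s := x s)) \<psi>'" using \<psi>' by blast
    then show ?l by auto
  qed
  then show ?case by blast
qed

lemma ex_sat_exi:
  "\<exists>\<psi>'. \<forall>e. sat M e \<psi>' \<longleftrightarrow> (\<exists>x. sat M (\<lambda>i. if i \<in> S then x i else e i) \<psi>)"
proof -
  obtain N where N: "\<forall>e e'. (\<forall>i<N. e i = e' i) \<longrightarrow> sat M e \<psi> = sat M e' \<psi>"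
    using sat_finite_support by blast
  obtain \<psi>' where "\<forall>e. sat M e \<psi>' \<longleftrightarrow> (\<exists>x. sat M (\<lambda>i. if i \<in> S \<inter> {..<N} then x i else e i) \<psi>)"
    using ex_sat_exi_finite[of "S \<inter> {..<N}" M \<psi>] by auto
  moreover have "sat M (\<lambda>i. if i \<in> S \<inter> {..<N} then x i else e i) \<psi> = sat M (\<lambda>i. if i \<in> S then x i else e i) \<psi>" for x e
    by (intro N[rule_format]) auto
  ultimately show ?thesis by auto
qed

section \<open>Definable predicates and terms\<close>

text \<open>
  An environment \<open>e\<close> assigns to every de Bruijn index \<open>v\<close> a vector \<open>e v\<close> of elements of \<open>M\<close>; the
  quantifier rules below bind the index \<open>0\<close>. In \<open>def_pred\<close>, \<open>\<tau>\<close> sends each variable of the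
  formula either to a coordinate of the environment or to a parameter.
\<close>

definition eval_var :: "(nat \<Rightarrow> nat \<Rightarrow> 'a) \<Rightarrow> (nat \<times> nat) + 'a \<Rightarrow> 'a" where
  "eval_var e t = (case t of Inl (v, k) \<Rightarrow> e v k | Inr a \<Rightarrow> a)"

definition def_pred ::
    "('f, 'r, 'a::linordered_ab_group_add) expansion \<Rightarrow> ((nat \<Rightarrow> nat \<Rightarrow> 'a) \<Rightarrow> bool) \<Rightarrow> bool" where
  "def_pred M Q \<longleftrightarrow> (\<exists>\<psi> \<tau>. \<forall>e. Q e = sat M (\<lambda>i. eval_var e (\<tau> i)) \<psi>)"

text \<open>A function is treated through its graph: coordinate 0 of index 0 holds the value, and
  the arguments move up by one index.\<close>

definition def_term ::
    "('f, 'r, 'a::linordered_ab_group_add) expansion \<Rightarrow> ((nat \<Rightarrow> nat \<Rightarrow> 'a) \<Rightarrow> 'a) \<Rightarrow> bool" where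
  "def_term M f \<longleftrightarrow> def_pred M (\<lambda>e. e 0 0 = f (\<lambda>i. e (Suc i)))"

lemma def_pred_sat: "def_pred M (\<lambda>e. sat M (\<lambda>i. eval_var e (\<tau> i)) \<psi>)"
  unfolding def_pred_def by blast

lemma def_pred_not: "def_pred M Q \<Longrightarrow> def_pred M (\<lambda>e. \<not> Q e)"
  unfolding def_pred_def by (metis sat.simps(4))

lemma def_pred_conj:
  assumes "def_pred M Q" "def_pred M R" shows "def_pred M (\<lambda>e. Q e \<and> R e)"
proof -
  obtain \<psi>1 \<tau>1 where 1: "\<And>e. Q e = sat M (\<lambda>i. eval_var e (\<tau>1 i)) \<psi>1"
    using assms unfolding def_pred_def by blast
  obtain \<psi>2 \<tau>2 where 2: "\<And>e. R e = sat M (\<lambda>i. eval_var e (\<tau>2 i)) \<psi>2"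
    using assms unfolding def_pred_def by blast
  \<comment> \<open>The two formulas may use one variable for different coordinates, so one moves to
    the even and the other to the odd variables.\<close>
  obtain \<psi>1' where r1: "\<And>e. sat M e \<psi>1' = sat M (e \<circ> (\<lambda>i. 2 * i)) \<psi>1"
    using ex_sat_rename by blast
  obtain \<psi>2' where r2: "\<And>e. sat M e \<psi>2' = sat M (e \<circ> (\<lambda>i. Suc (2 * i))) \<psi>2"
    using ex_sat_rename by blast
  have "(Q e \<and> R e) = sat M (\<lambda>i. eval_var e (if even i then \<tau>1 (i div 2) else \<tau>2 (i div 2))) (Conj \<psi>1' \<psi>2')" for e
    using 1 2 r1 r2 by (simp add: comp_def)
  then show ?thesis by (simp only: def_pred_sat)
qed

lemma def_pred_disj: "def_pred M Q \<Longrightarrow> def_pred M R \<Longrightarrow> def_pred M (\<lambda>e. Q e \<or> R e)"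
  using def_pred_not[OF def_pred_conj[OF def_pred_not def_pred_not], of M Q R] by simp

lemma def_pred_imp: "def_pred M Q \<Longrightarrow> def_pred M R \<Longrightarrow> def_pred M (\<lambda>e. Q e \<longrightarrow> R e)"
  unfolding imp_conv_disj by (intro def_pred_disj def_pred_not)

lemma def_pred_const: "def_pred M (\<lambda>_. c)"
proof -
  have T: "def_pred M (\<lambda>_. True)" using def_pred_sat[of M _ "Eq Zero Zero"] by simp
  show ?thesis using T def_pred_not[OF T] by (cases c) auto
qed

lemma def_pred_ball_finite:
  assumes "finite I" "\<And>j. j \<in> I \<Longrightarrow> def_pred M (Q j)"
  shows "def_pred M (\<lambda>e. \<forall>j\<in>I. Q j e)"
  using assms by (induction I) (auto intro!: def_pred_const def_pred_conj)

lemma def_pred_bex_finite: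
  assumes "finite I" "\<And>j. j \<in> I \<Longrightarrow> def_pred M (Q j)"
  shows "def_pred M (\<lambda>e. \<exists>j\<in>I. Q j e)"
  using assms by (induction I) (auto intro!: def_pred_const def_pred_disj)

lemma def_pred_all_less:
  fixes n :: nat
  assumes "\<And>k. k < n \<Longrightarrow> def_pred M (Q k)"
  shows "def_pred M (\<lambda>e. \<forall>k<n. Q k e)"
  using def_pred_ball_finite[of "{..<n}" M Q] assms by (simp add: Ball_def)

lemma def_pred_ex_vec:
  assumes "def_pred M (\<lambda>e. R (\<lambda>i. e (Suc i)) (e 0))"
  shows "def_pred M (\<lambda>e. \<exists>x. R e x)"
proof -
  obtain \<psi> \<tau> where \<psi>: "\<And>e. R (\<lambda>i. e (Suc i)) (e 0) = sat M (\<lambda>i. eval_var e (\<tau> i)) \<psi>"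
    using assms unfolding def_pred_def by blast
  \<comment> \<open>Even variables carry the quantified vector, odd variables everything else;
    \<open>\<rho>\<close> gives the odd ones their values with the index lowered by one. Its value
    \<open>Inr 0\<close> is never read.\<close>
  define \<sigma> where "\<sigma> = (\<lambda>i. case \<tau> i of Inl (0, k) \<Rightarrow> 2 * k | _ \<Rightarrow> Suc (2 * i))"
  define \<rho> where "\<rho> = (\<lambda>j. case \<tau> (j div 2) of Inl (Suc v, k) \<Rightarrow> Inl (v, k) | Inl (0, k) \<Rightarrow> Inr 0 | Inr a \<Rightarrow> Inr a)"
  obtain \<psi>1 where \<psi>1: "\<And>e. sat M e \<psi>1 = sat M (e \<circ> \<sigma>) \<psi>" using ex_sat_rename by blast
  obtain \<psi>2 where \<psi>2: "\<And>e. sat M e \<psi>2 = (\<exists>x. sat M (\<lambda>i. if i \<in> {i. even i} then x i else e i) \<psi>1)"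
    using ex_sat_exi by blast
  have *: "R e x = sat M (\<lambda>i. if i \<in> {i. even i} then y i else eval_var e (\<rho> i)) \<psi>1"
    if y: "\<And>k. x k = y (2 * k)" for e x y
  proof -
    have "R e x = sat M (\<lambda>i. eval_var (case_nat x e) (\<tau> i)) \<psi>" using \<psi>[of "case_nat x e"] by simp
    also have "(\<lambda>i. eval_var (case_nat x e) (\<tau> i)) = (\<lambda>i. if i \<in> {i. even i} then y i else eval_var e (\<rho> i)) \<circ> \<sigma>"
      by (rule ext) (auto simp: \<sigma>_def \<rho>_def eval_var_def y split: sum.splits nat.splits)
    finally show ?thesis by (simp only: \<psi>1)
  qed
  have "(\<exists>x. R e x) = sat M (\<lambda>i. eval_var e (\<rho> i)) \<psi>2" for e
    unfolding \<psi>2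
  proof
    assume "\<exists>x. R e x"
    then obtain x where "R e x" by blast
    then show "\<exists>y. sat M (\<lambda>i. if i \<in> {i. even i} then y i else eval_var e (\<rho> i)) \<psi>1"
      using *[of x "\<lambda>i. x (i div 2)" e] by auto
  next
    assume "\<exists>y. sat M (\<lambda>i. if i \<in> {i. even i} then y i else eval_var e (\<rho> i)) \<psi>1"
    then obtain y where "sat M (\<lambda>i. if i \<in> {i. even i} then y i else eval_var e (\<rho> i)) \<psi>1" ..
    then show "\<exists>x. R e x" using *[of "\<lambda>k. y (2 * k)" y e] by blast
  qed
  then show ?thesis by (simp only: def_pred_sat)
qed

lemma def_pred_rename:
  assumes "def_pred M Q"
  shows "def_pred M (\<lambda>e. Q (\<lambda>v k. eval_var e (\<rho> v k)))"
proof -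
  obtain \<psi> \<tau> where \<psi>: "\<And>e. Q e = sat M (\<lambda>i. eval_var e (\<tau> i)) \<psi>"
    using assms unfolding def_pred_def by blast
  have "Q (\<lambda>v k. eval_var e (\<rho> v k)) =
     sat M (\<lambda>i. eval_var e (case \<tau> i of Inl (v, k) \<Rightarrow> \<rho> v k | Inr a \<Rightarrow> Inr a)) \<psi>" for e
    unfolding \<psi> by (rule arg_cong[where f = "\<lambda>e. sat M e \<psi>"]) (auto simp: eval_var_def split: sum.splits)
  then show ?thesis by (simp only: def_pred_sat)
qed

lemma def_term_shift:
  assumes "def_term M f" shows "def_term M (\<lambda>e. f (\<lambda>i. e (Suc i)))"
  using def_pred_rename[OF assms[unfolded def_term_def],
      of "\<lambda>v k. Inl (if v = 0 then 0 else Suc v, k)"]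
  by (simp add: def_term_def eval_var_def)

text \<open>Terms of the language need not express \<open>F\<close>, so its values enter through a
  quantified vector tied to the graphs of the coordinates of \<open>F\<close>. By finite support,
  finitely many ties suffice.\<close>

lemma def_pred_subst:
  assumes Q: "def_pred M Q" and F: "\<And>v k. def_term M (\<lambda>e. F e v k)"
  shows "def_pred M (\<lambda>e. Q (F e))"
proof -
  obtain \<psi> \<tau> where \<psi>: "\<And>e. Q e = sat M (\<lambda>i. eval_var e (\<tau> i)) \<psi>"
    using Q unfolding def_pred_def by blast
  obtain N where N: "\<forall>e e'. (\<forall>i<N. e i = e' i) \<longrightarrow> sat M e \<psi> = sat M e' \<psi>"
    using sat_finite_support by blast
  have 1: "def_pred M (\<lambda>e. e 0 i = eval_var (F (\<lambda>i. e (Suc i))) (\<tau> i))" for i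
  proof (cases "\<tau> i")
    case (Inl p)
    then show ?thesis
      using def_pred_rename[OF F[unfolded def_term_def, of "fst p" "snd p"],
        of "\<lambda>v k. if v = 0 then Inl (0, i) else Inl (v, k)"]
      by (simp add: eval_var_def split_beta)
  next
    case (Inr a)
    then show ?thesis
      using def_pred_sat[of M "\<lambda>j. if j = 0 then Inl (0, i) else Inr a" "Eq (Var 0) (Var 1)"]
      by (simp add: eval_var_def)
  qed
  have 2: "def_pred M (\<lambda>e. sat M (e 0) \<psi>)"
    using def_pred_sat[of M "\<lambda>j. Inl (0, j)" \<psi>] by (simp add: eval_var_def)
  have "def_pred M (\<lambda>e. \<exists>x. (\<forall>i<N. x i = eval_var (F e) (\<tau> i)) \<and> sat M x \<psi>)"
    by (intro def_pred_ex_vec def_pred_conj def_pred_all_less 1 2)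
  moreover have "(\<exists>x. (\<forall>i<N. x i = eval_var (F e) (\<tau> i)) \<and> sat M x \<psi>) = Q (F e)" for e
  proof
    assume "\<exists>x. (\<forall>i<N. x i = eval_var (F e) (\<tau> i)) \<and> sat M x \<psi>"
    then obtain x where x: "\<forall>i<N. x i = eval_var (F e) (\<tau> i)" "sat M x \<psi>" by auto
    then show "Q (F e)" using N[rule_format, of x "\<lambda>i. eval_var (F e) (\<tau> i)"] \<psi>[of "F e"] by simp
  next
    assume "Q (F e)"
    then show "\<exists>x. (\<forall>i<N. x i = eval_var (F e) (\<tau> i)) \<and> sat M x \<psi>"
      unfolding \<psi> by (intro exI[of _ "\<lambda>i. eval_var (F e) (\<tau> i)"]) simp
  qed
  ultimately show ?thesis by simp
qed

lemma def_term_var: "def_term M (\<lambda>e. e v k)"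
  using def_pred_sat[of M "\<lambda>j. if j = 0 then Inl (0, 0) else Inl (Suc v, k)" "Eq (Var 0) (Var 1)"]
  by (simp add: eval_var_def def_term_def)

lemma def_term_const: "def_term M (\<lambda>e. c)"
  using def_pred_sat[of M "\<lambda>j. if j = 0 then Inl (0, 0) else Inr c" "Eq (Var 0) (Var 1)"]
  by (simp add: eval_var_def def_term_def)

lemma def_pred_subst3:
  assumes "def_pred M (\<lambda>e. R (e 0 0) (e 1 0) (e 2 0))" "def_term M f" "def_term M g" "def_term M h"
  shows "def_pred M (\<lambda>e. R (f e) (g e) (h e))"
proof -
  have "def_term M (\<lambda>e. if v = (0::nat) then f e else if v = 1 then g e else h e)" for v
    using assms(2-) by (cases "v = 0"; cases "v = 1") auto
  from def_pred_subst[OF assms(1), of "\<lambda>e v k. if v = 0 then f e else if v = 1 then g e else h e", OF this]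
  show ?thesis by simp
qed

lemma def_pred_eq: "def_term M f \<Longrightarrow> def_term M g \<Longrightarrow> def_pred M (\<lambda>e. f e = g e)"
  using def_pred_subst3[of M "\<lambda>x y z. x = y" f g g]
    def_pred_sat[of M "\<lambda>j. Inl (j, 0)" "Eq (Var 0) (Var 1)"] by (simp add: eval_var_def)

lemma def_pred_less: "def_term M f \<Longrightarrow> def_term M g \<Longrightarrow> def_pred M (\<lambda>e. f e < g e)"
  using def_pred_subst3[of M "\<lambda>x y z. x < y" f g g]
    def_pred_sat[of M "\<lambda>j. Inl (j, 0)" "Less (Var 0) (Var 1)"] by (simp add: eval_var_def)

lemma def_pred_le: "def_term M f \<Longrightarrow> def_term M g \<Longrightarrow> def_pred M (\<lambda>e. f e \<le> g e)"
  unfolding not_less[symmetric] by (intro def_pred_not def_pred_less)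

lemma def_term_add:
  assumes "def_term M f" "def_term M g" shows "def_term M (\<lambda>e. f e + g e)"
  unfolding def_term_def
  by (rule def_pred_subst3[of M "\<lambda>x y z. x = y + z"])
    (use def_pred_sat[of M "\<lambda>j. Inl (j, 0)" "Eq (Var 0) (Plus (Var 1) (Var 2))"] in
      \<open>simp_all add: eval_var_def def_term_var def_term_shift assms\<close>)

lemma def_term_uminus:
  assumes "def_term M f" shows "def_term M (\<lambda>e. - f e)"
proof -
  have "def_pred M (\<lambda>e. e 0 0 + f (\<lambda>i. e (Suc i)) = 0)"
    by (intro def_pred_eq def_term_add def_term_var def_term_shift[OF assms] def_term_const)
  then show ?thesis unfolding def_term_def eq_neg_iff_add_eq_0 .
qed

lemma def_term_diff: "def_term M f \<Longrightarrow> def_term M g \<Longrightarrow> def_term M (\<lambda>e. f e - g e)"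
  using def_term_add[OF _ def_term_uminus, of M f g] by simp

lemma def_pred_shift: "def_pred M Q \<Longrightarrow> def_pred M (\<lambda>e. Q (\<lambda>i. e (Suc i)))"
  by (rule def_pred_subst[of M Q "\<lambda>e v. e (Suc v)"]) (assumption, rule def_term_var)

lemma def_pred_if:
  "def_pred M B \<Longrightarrow> def_pred M Q \<Longrightarrow> def_pred M R \<Longrightarrow> def_pred M (\<lambda>e. if B e then Q e else R e)"
  unfolding if_bool_eq_conj by (intro def_pred_conj def_pred_imp def_pred_not)

lemma def_term_if:
  assumes "def_pred M B" "def_term M f" "def_term M g"
  shows "def_term M (\<lambda>e. if B e then f e else g e)"
proof -
  have "def_pred M (\<lambda>e. if B (\<lambda>i. e (Suc i)) then e 0 0 = f (\<lambda>i. e (Suc i)) else e 0 0 = g (\<lambda>i. e (Suc i)))"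
    by (intro def_pred_if def_pred_shift[OF assms(1)] def_pred_eq def_term_var
        def_term_shift[OF assms(2)] def_term_shift[OF assms(3)])
  then show ?thesis unfolding def_term_def by (rule back_subst[of "def_pred M"]) auto
qed

lemma def_term_max: "def_term M f \<Longrightarrow> def_term M g \<Longrightarrow> def_term M (\<lambda>e. max (f e) (g e))"
  unfolding max_def by (intro def_term_if def_pred_le)

lemma def_term_min: "def_term M f \<Longrightarrow> def_term M g \<Longrightarrow> def_term M (\<lambda>e. min (f e) (g e))"
  unfolding min_def by (intro def_term_if def_pred_le)

lemma def_pred_ex:
  assumes "def_pred M (\<lambda>e. R (\<lambda>i. e (Suc i)) (e 0 0))"
  shows "def_pred M (\<lambda>e. \<exists>a. R e a)"
proof -
  have "def_pred M (\<lambda>e. \<exists>x. R e (x (0::nat)))"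
    using def_pred_ex_vec[of M "\<lambda>e x. R e (x 0)"] assms by simp
  moreover have "(\<exists>x. R e (x (0::nat))) = (\<exists>a. R e a)" for e
    by (auto intro: exI[of _ "\<lambda>_. _"])
  ultimately show ?thesis by simp
qed

lemma def_pred_all:
  assumes "def_pred M (\<lambda>e. R (\<lambda>i. e (Suc i)) (e 0 0))"
  shows "def_pred M (\<lambda>e. \<forall>a. R e a)"
  using def_pred_not[OF def_pred_ex[of M "\<lambda>e a. \<not> R e a"]] def_pred_not[OF assms] by simp

text \<open>Together with \<open>definable_if_def_pred\<close> this translates between definable
  sets and definable predicates; \<open>restrict\<close> mediates between the vectors of an
  environment, which are total, and the extensional points of \<open>M\<^sup>n\<close>.\<close>

lemma def_pred_mem:
  assumes A: "definable M n A" and F: "\<And>k. k < n \<Longrightarrow> def_term M (\<lambda>e. F e k)"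
  shows "def_pred M (\<lambda>e. restrict (F e) {..<n} \<in> A)"
proof -
  obtain \<phi> p where \<phi>: "A = {x \<in> Mpow n. sat M (\<lambda>i. if i < n then x i else p i) \<phi>}"
    using A unfolding definable_def by blast
  have "def_pred M (\<lambda>e. sat M (e 0) \<phi>)"
    using def_pred_sat[of M "\<lambda>j. Inl (0, j)" \<phi>] by (simp add: eval_var_def)
  moreover have "def_term M (\<lambda>e. if i < n then F e i else p i)" for i
    using F by (cases "i < n") (auto intro: def_term_const)
  ultimately have "def_pred M (\<lambda>e. sat M (\<lambda>i. if i < n then F e i else p i) \<phi>)"
    using def_pred_subst[of M "\<lambda>e. sat M (e 0) \<phi>" "\<lambda>e v i. if i < n then F e i else p i"] by simp
  moreover have "restrict (F e) {..<n} \<in> A \<longleftrightarrow> sat M (\<lambda>i. if i < n then F e i else p i) \<phi>" for e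
    unfolding \<phi> by (simp add: Mpow_def cong: if_cong)
  ultimately show ?thesis by simp
qed

lemma definable_if_def_pred:
  assumes "def_pred M (\<lambda>e. Q (restrict (e 0) {..<n}))"
  shows "definable M n {x \<in> Mpow n. Q x}"
proof -
  obtain \<psi> \<tau> where \<psi>: "\<And>e. Q (restrict (e 0) {..<n}) = sat M (\<lambda>i. eval_var e (\<tau> i)) \<psi>"
    using assms unfolding def_pred_def by blast
  \<comment> \<open>Coordinates of the point keep their variables; all other variables become
    parameters from \<open>n\<close> on. Coordinates \<open>k \<ge> n\<close> of an extensional
    point are \<open>undefined\<close>, and \<open>p\<close> gives them that value.\<close>
  define \<sigma> where "\<sigma> = (\<lambda>i. case \<tau> i of Inl (0, k) \<Rightarrow> if k < n then k else n + i | _ \<Rightarrow> n + i)"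
  define p where "p = (\<lambda>j. eval_var (\<lambda>_ _. undefined) (\<tau> (j - n)))"
  obtain \<psi>' where \<psi>': "\<And>e. sat M e \<psi>' = sat M (e \<circ> \<sigma>) \<psi>" using ex_sat_rename by blast
  have "Q x = sat M (\<lambda>i. if i < n then x i else p i) \<psi>'" if x: "x \<in> Mpow n" for x
  proof -
    define e where "e = (\<lambda>v. if v = (0::nat) then x else (\<lambda>_::nat. undefined))"
    have und: "x k = undefined" if "\<not> k < n" for k
      using x that unfolding Mpow_def by (auto intro: PiE_arb)
    have "restrict (e 0) {..<n} = x" using x by (simp add: Mpow_def e_def PiE_restrict)
    then have "Q x = sat M (\<lambda>i. eval_var e (\<tau> i)) \<psi>" using \<psi>[of e] by simp
    also have "(\<lambda>i. eval_var e (\<tau> i)) = (\<lambda>i. if i < n then x i else p i) \<circ> \<sigma>"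
    proof (rule ext)
      fix i
      show "eval_var e (\<tau> i) = ((\<lambda>i. if i < n then x i else p i) \<circ> \<sigma>) i"
      proof (cases "\<tau> i")
        case (Inl q)
        obtain v k where "q = (v, k)" by (cases q)
        then show ?thesis using Inl und by (cases v) (simp_all add: e_def \<sigma>_def p_def eval_var_def)
      qed (simp add: \<sigma>_def p_def eval_var_def)
    qed
    finally show ?thesis by (simp only: \<psi>')
  qed
  then have "{x \<in> Mpow n. Q x} = {x \<in> Mpow n. sat M (\<lambda>i. if i < n then x i else p i) \<psi>'}" by auto
  then show ?thesis unfolding definable_def by blast
qed

section \<open>Closeness in ordered groups\<close>

text \<open>The inequality |a - b| < s, written with \<open><\<close> and \<open>+\<close> alone and
  hence directly a formula of the language.\<close>

definition close :: "'a::linordered_ab_group_add \<Rightarrow> 'a \<Rightarrow> 'a \<Rightarrow> bool" where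
  "close s a b \<longleftrightarrow> a < b + s \<and> b < a + s"

definition wclose :: "'a::linordered_ab_group_add \<Rightarrow> 'a \<Rightarrow> 'a \<Rightarrow> bool" where
  "wclose s a b \<longleftrightarrow> a \<le> b + s \<and> b \<le> a + s"

lemma close_sym: "close s a b \<longleftrightarrow> close s b a"
  by (auto simp: close_def)

lemma wclose_sym: "wclose s a b \<longleftrightarrow> wclose s b a"
  by (auto simp: wclose_def)

lemma close_refl: "0 < s \<Longrightarrow> close s a a"
  by (simp add: close_def)

lemma wclose_refl: "0 \<le> s \<Longrightarrow> wclose s a a"
  by (simp add: wclose_def)

lemma close_wclose: "close s a b \<Longrightarrow> wclose s a b"
  by (auto simp: close_def wclose_def)

lemma wclose_close: "wclose s a b \<Longrightarrow> s < t \<Longrightarrow> close t a b"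
  by (auto simp: close_def wclose_def intro: le_less_trans)

lemma close_mono: "close s a b \<Longrightarrow> s \<le> t \<Longrightarrow> close t a b"
  by (auto simp: close_def intro: less_le_trans)

lemma wclose_mono: "wclose s a b \<Longrightarrow> s \<le> t \<Longrightarrow> wclose t a b"
  by (auto simp: wclose_def intro: order_trans)

lemma wclose_trans:
  assumes "wclose s a b" "wclose t b c" shows "wclose (s + t) a c"
proof -
  have "a \<le> (c + t) + s" "c \<le> (a + s) + t"
    using assms unfolding wclose_def by (meson add_right_mono order_trans)+
  then show ?thesis by (simp add: wclose_def add_ac)
qed

lemma close_trans:
  assumes "close s a b" "close t b c" shows "close (s + t) a c"
proof -
  have "a < (c + t) + s" "c < (a + s) + t"
    using assms unfolding close_def by (meson add_strict_right_mono less_trans)+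
  then show ?thesis by (simp add: close_def add_ac)
qed

lemma wclose_zeroI: "a \<le> K \<Longrightarrow> - a \<le> K \<Longrightarrow> wclose K a 0"
  using add_left_mono[of "- a" K a] by (simp add: wclose_def)

text \<open>If \<open>a\<close> exceeded \<open>c + s\<close>, the excess itself would be a
  tolerance \<open>u\<close> that no \<open>b\<close> can meet; likewise for \<open>c\<close> and
  \<open>a + s\<close>.\<close>

lemma wclose_limit:
  assumes "\<And>u. 0 < u \<Longrightarrow> \<exists>b. wclose s a b \<and> close u b c"
  shows "wclose s a c"
proof -
  have "a \<le> c + s"
  proof (rule ccontr)
    assume "\<not> a \<le> c + s"
    then have "0 < a - (c + s)" by simp
    then obtain b where "a \<le> b + s" "b < c + (a - (c + s))"
      using assms unfolding close_def wclose_def by blast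
    then have "a < c + (a - (c + s)) + s" by (meson add_strict_right_mono le_less_trans)
    then show False by (simp add: algebra_simps)
  qed
  moreover have "c \<le> a + s"
  proof (rule ccontr)
    assume "\<not> c \<le> a + s"
    then have "0 < c - (a + s)" by simp
    then obtain b where "b \<le> a + s" "c < b + (c - (a + s))"
      using assms unfolding close_def wclose_def by blast
    then have "c < (a + s) + (c - (a + s))" by (meson add_right_mono less_le_trans)
    then show False by (simp add: algebra_simps)
  qed
  ultimately show ?thesis by (simp add: wclose_def)
qed

lemma open_close: "open {b. close s a (b::'a::{linordered_ab_group_add, linorder_topology})}"
proof -
  have "{b. close s a b} = {a - s<..<a + s}" by (auto simp: close_def diff_less_eq)
  then show ?thesis by simp
qed

text \<open>The positive element \<open>e\<close> provides points on both sides of \<open>a\<close>;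
  in the trivial group there would be no positive \<open>s\<close> at all.\<close>

lemma open_contains_close:
  fixes a :: "'a::{linordered_ab_group_add, linorder_topology}"
  assumes "open S" "a \<in> S" "0 < (e::'a)"
  shows "\<exists>s>0. \<forall>b. close s a b \<longrightarrow> b \<in> S"
proof -
  obtain r where r: "r > a" "{a..<r} \<subseteq> S"
    using open_right[OF assms(1,2), of "a + e"] assms(3) by auto
  obtain l where l: "l < a" "{l<..a} \<subseteq> S"
    using open_left[OF assms(1,2), of "a - e"] assms(3) by auto
  show ?thesis
  proof (intro exI[of _ "min (r - a) (a - l)"] conjI allI impI)
    show "0 < min (r - a) (a - l)" using r l by simp
    fix b assume "close (min (r - a) (a - l)) a b"
    then have "b < a + (r - a)" "a < b + (a - l)"
      unfolding close_def by (meson add_left_mono less_le_trans min.cobounded1 min.cobounded2)+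
    then have "b < r" "l < b" by (simp_all add: algebra_simps)
    then show "b \<in> S" using r l by (cases "a \<le> b") auto
  qed
qed

lemma ex_pos_all_less:
  fixes P :: "nat \<Rightarrow> 'a::linordered_ab_group_add \<Rightarrow> bool" and m :: nat
  assumes "0 < (e::'a)" and "\<And>k. k < m \<Longrightarrow> \<exists>s>0. P k s"
    and mono: "\<And>k s t. P k s \<Longrightarrow> 0 < t \<Longrightarrow> t \<le> s \<Longrightarrow> P k t"
  shows "\<exists>s>0. \<forall>k<m. P k s"
  using assms(2)
proof (induction m)
  case 0
  then show ?case using assms(1) by auto
next
  case (Suc m)
  then obtain s where s: "s > 0" "\<forall>k<m. P k s" by (meson less_Suc_eq)
  obtain t where t: "t > 0" "P m t" using Suc.prems by blast
  have "\<forall>k<Suc m. P k (min s t)"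
    using s t by (auto simp: less_Suc_eq intro: mono)
  then show ?case using s t by (intro exI[of _ "min s t"]) simp
qed

lemma ex_bound_all_less:
  fixes f :: "nat \<Rightarrow> 'a::linorder" and m :: nat
  shows "\<exists>K\<ge>c. \<forall>k<m. f k \<le> K"
proof (induction m)
  case (Suc m)
  then obtain K where "K \<ge> c" "\<forall>k<m. f k \<le> K" by blast
  then show ?case by (intro exI[of _ "max K (f m)"]) (auto simp: less_Suc_eq le_max_iff_disj)
qed auto

text \<open>Negation, \<open>min\<close> and \<open>max\<close> all preserve a common error
  \<open>s\<close>, so clamping is 1-Lipschitz jointly in the value and the bound.\<close>

lemma close_clamp:
  assumes "close s a a'" "close s c c'"
  shows "close s (max (- c) (min c a)) (max (- c') (min c' (a'::'a::linordered_ab_group_add)))"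
proof -
  have key: "max (- c) (min c a) < max (- c') (min c' a') + s"
    if *: "a < a' + s" "c < c' + s" "c' < c + s" for a a' c c' :: 'a
  proof -
    have "- c < - c' + s" using *(3) by (metis add.commute diff_less_eq minus_diff_eq neg_less_iff_less uminus_add_conv_diff add_diff_cancel_left')
    then have "- c < max (- c') (min c' a') + s"
      by (meson add_right_mono less_le_trans max.cobounded1)
    moreover have "min c a < min c' a' + s"
      unfolding min_add_distrib_left using * by (auto simp: min_less_iff_disj)
    then have "min c a < max (- c') (min c' a') + s"
      by (meson add_right_mono less_le_trans max.cobounded2)
    ultimately show ?thesis by simp
  qed
  show ?thesis using assms unfolding close_def by (blast intro: key)
qed

text \<open>Nothing is assumed about \<open>a\<close>: a small bound alone pins the clamped value
  near 0. This absorbs the uncontrolled coordinates near the edge of a chart.\<close>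

lemma close_clamp_zero:
  assumes "close s c 0" "0 \<le> c"
  shows "close s (max (- c) (min c a)) (0::'a::linordered_ab_group_add)"
proof -
  have c: "c < s" "0 < s" using assms by (auto simp: close_def)
  have "- s < - c" using c by simp
  also have "\<dots> \<le> max (- c) (min c a)" by simp
  finally have "0 < max (- c) (min c a) + s" by (metis add.commute diff_0 diff_less_eq)
  moreover have "max (- c) (min c a) < s" using c assms(2) by (auto simp: min_less_iff_disj intro: le_less_trans[of _ 0])
  ultimately show ?thesis by (simp add: close_def)
qed

section \<open>Pseudo-definable spaces in coordinates\<close>

text \<open>\<open>half\<close> takes the place of division by two in triangle inequality arguments
  and \<open>ex_pos\<close> excludes the trivial group; both are supplied by the ordered
  field.\<close>

locale pd_space =
  fixes M :: "('f, 'r, 'a::{linordered_ab_group_add, linorder_topology}) expansion"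
    and X :: "('s, 'i, 'a) atlas_space"
  assumes pds: "pseudo_definable_space M X"
    and half: "\<And>s::'a. 0 < s \<Longrightarrow> \<exists>t>0. t + t = s"
    and ex_pos: "\<exists>e::'a. 0 < e"
begin

abbreviation "pts \<equiv> topspace (space_top X)"

text \<open>The default 0 makes coordinates total functions, so that they can be used as terms;
  membership in the chart is tested separately.\<close>

definition crd :: "'i \<Rightarrow> 's \<Rightarrow> nat \<Rightarrow> 'a" where
  "crd i x k = (if x \<in> chart_dom X i \<and> k < chart_dim X i then chart X i x k else 0)"

definition chart_ball :: "'i \<Rightarrow> 's \<Rightarrow> 'a \<Rightarrow> 's set" where
  "chart_ball i x s = {y \<in> chart_dom X i. \<forall>k<chart_dim X i. close s (crd i x k) (crd i y k)}"

definition chart_cball :: "'i \<Rightarrow> 's \<Rightarrow> 'a \<Rightarrow> 's set" where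
  "chart_cball i x s = {y \<in> chart_dom X i. \<forall>k<chart_dim X i. wclose s (crd i x k) (crd i y k)}"

lemma fin_idx: "finite (chart_idx X)"
  using pds by (simp add: pseudo_definable_space_def)

lemma open_dom: "i \<in> chart_idx X \<Longrightarrow> openin (space_top X) (chart_dom X i)"
  using pds by (simp add: pseudo_definable_space_def)

lemma dom_pts: "i \<in> chart_idx X \<Longrightarrow> x \<in> chart_dom X i \<Longrightarrow> x \<in> pts"
  using open_dom openin_subset by blast

lemma ex_chart: "x \<in> pts \<Longrightarrow> \<exists>i\<in>chart_idx X. x \<in> chart_dom X i"
proof -
  assume x: "x \<in> pts"
  have "(\<Union>i\<in>chart_idx X. chart_dom X i) = pts"
    using pds by (simp add: pseudo_definable_space_def)
  then show ?thesis using x by blast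
qed

lemma definable_codom: "i \<in> chart_idx X \<Longrightarrow> definable M (chart_dim X i) (chart X i ` chart_dom X i)"
  using pds by (simp add: pseudo_definable_space_def)

lemma transition:
  "i \<in> chart_idx X \<Longrightarrow> j \<in> chart_idx X \<Longrightarrow> i \<noteq> j \<Longrightarrow> chart_dom X i \<inter> chart_dom X j \<noteq> {} \<Longrightarrow>
    definable_homeomorphism M
          (chart_dim X i) (chart X i ` (chart_dom X i \<inter> chart_dom X j))
          (chart_dim X j) (chart X j ` (chart_dom X i \<inter> chart_dom X j))
          (chart X j \<circ> inv_into (chart_dom X i \<inter> chart_dom X j) (chart X i))"
  using pds by (simp add: pseudo_definable_space_def)

lemma homeo_chart:
  "i \<in> chart_idx X \<Longrightarrow> homeomorphic_map (subtopology (space_top X) (chart_dom X i))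
          (subtopology (Mpow_top (chart_dim X i)) (chart X i ` chart_dom X i)) (chart X i)"
  using pds by (simp add: pseudo_definable_space_def)

lemma chart_Mpow:
  assumes "i \<in> chart_idx X" "x \<in> chart_dom X i" shows "chart X i x \<in> Mpow (chart_dim X i)"
  using definable_codom[OF assms(1)] assms(2) by (auto simp: definable_def)

lemma topspace_Mpow_top: "topspace (Mpow_top n) = Mpow n"
  by (simp add: Mpow_top_def Mpow_def)

lemma inj_chart:
  assumes "i \<in> chart_idx X" shows "inj_on (chart X i) (chart_dom X i)"
  using homeomorphic_imp_injective_map[OF homeo_chart[OF assms]] openin_subset[OF open_dom[OF assms]]
  by (simp add: Int_absorb1)

lemma chart_ball_self: "x \<in> chart_dom X i \<Longrightarrow> 0 < s \<Longrightarrow> x \<in> chart_ball i x s"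
  by (simp add: chart_ball_def close_refl)

lemma open_chart_ball:
  assumes i: "i \<in> chart_idx X"
  shows "openin (space_top X) (chart_ball i x s)"
proof -
  let ?B = "PiE {..<chart_dim X i} (\<lambda>k. {b. close s (crd i x k) b})"
  let ?U = "chart_dom X i"
  have "openin (Mpow_top (chart_dim X i)) ?B"
    unfolding Mpow_top_def by (subst openin_PiE_gen) (simp add: open_close)
  then have "openin (subtopology (Mpow_top (chart_dim X i)) (chart X i ` ?U)) (?B \<inter> chart X i ` ?U)"
    by (auto simp: openin_subtopology)
  then have "openin (subtopology (space_top X) ?U)
      {y \<in> topspace (subtopology (space_top X) ?U). chart X i y \<in> ?B \<inter> chart X i ` ?U}"
    using openin_continuous_map_preimage[OF homeomorphic_imp_continuous_map[OF homeo_chart[OF i]]] by blast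
  moreover have "{y \<in> topspace (subtopology (space_top X) ?U). chart X i y \<in> ?B \<inter> chart X i ` ?U} = chart_ball i x s"
    using chart_Mpow[OF i] dom_pts[OF i]
    by (auto simp: chart_ball_def crd_def Mpow_def PiE_iff)
  ultimately show ?thesis using open_dom[OF i] openin_trans_full by fastforce
qed

lemma ex_chart_ball_subset:
  assumes i: "i \<in> chart_idx X" and x: "x \<in> chart_dom X i" "x \<in> V" and V: "openin (space_top X) V"
  shows "\<exists>s>0. chart_ball i x s \<subseteq> V"
proof -
  let ?U = "chart_dom X i" and ?m = "chart_dim X i"
  obtain e :: 'a where e: "0 < e" using ex_pos by blast
  have "openin (subtopology (space_top X) ?U) (V \<inter> ?U)"
    using V by (auto simp: openin_subtopology)
  then have "openin (subtopology (Mpow_top ?m) (chart X i ` ?U)) (chart X i ` (V \<inter> ?U))"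
    using homeomorphic_imp_open_map[OF homeo_chart[OF i]] by (simp add: open_map_def)
  then obtain W where W: "openin (Mpow_top ?m) W" "chart X i ` (V \<inter> ?U) = W \<inter> chart X i ` ?U"
    by (auto simp: openin_subtopology)
  then have "chart X i x \<in> W" using x by blast
  then obtain S where S: "\<And>k. k < ?m \<Longrightarrow> open (S k)" "chart X i x \<in> PiE {..<?m} S" "PiE {..<?m} S \<subseteq> W"
    using W(1) unfolding Mpow_top_def openin_product_topology_alt by (metis lessThan_iff open_openin)
  have "\<exists>s>0. \<forall>k<?m. \<forall>b. close s (crd i x k) b \<longrightarrow> b \<in> S k"
  proof (rule ex_pos_all_less[OF e])
    fix k assume k: "k < ?m"
    then have "crd i x k \<in> S k" using S(2) x by (auto simp: crd_def PiE_iff)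
    then show "\<exists>s>0. \<forall>b. close s (crd i x k) b \<longrightarrow> b \<in> S k"
      using open_contains_close S(1)[OF k] e by blast
  qed (blast intro: close_mono)
  then obtain s where s: "s > 0" "\<And>k b. k < ?m \<Longrightarrow> close s (crd i x k) b \<Longrightarrow> b \<in> S k" by blast
  have "chart_ball i x s \<subseteq> V"
  proof
    fix y assume "y \<in> chart_ball i x s"
    then have y: "y \<in> ?U" "\<And>k. k < ?m \<Longrightarrow> crd i y k \<in> S k"
      using s by (auto simp: chart_ball_def)
    then have "chart X i y \<in> PiE {..<?m} S"
      using chart_Mpow[OF i y(1)] by (auto simp: PiE_iff Mpow_def crd_def)
    then have "chart X i y \<in> chart X i ` (V \<inter> ?U)" using S(3) W(2) y(1) by blast
    then show "y \<in> V" using inj_chart[OF i] y(1) by (auto dest: inj_onD)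
  qed
  then show ?thesis using s(1) by blast
qed

lemma in_closure_chart:
  assumes "S \<subseteq> pts" "i \<in> chart_idx X" "z \<in> chart_dom X i"
  shows "z \<in> space_top X closure_of S \<longleftrightarrow> (\<forall>u>0. \<exists>w\<in>S. w \<in> chart_ball i z u)"
proof
  assume "z \<in> space_top X closure_of S"
  then show "\<forall>u>0. \<exists>w\<in>S. w \<in> chart_ball i z u"
    using open_chart_ball[OF assms(2)] chart_ball_self[OF assms(3)] by (simp add: in_closure_of) blast
next
  assume "\<forall>u>0. \<exists>w\<in>S. w \<in> chart_ball i z u"
  then have "\<exists>y. y \<in> S \<and> y \<in> V" if "z \<in> V" "openin (space_top X) V" for V
    using ex_chart_ball_subset[OF assms(2,3) that] by blast
  then show "z \<in> space_top X closure_of S"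
    using dom_pts[OF assms(2,3)] by (simp add: in_closure_of)
qed

text \<open>One chart around \<open>z\<close> already decides, so quantifying over all of them
  changes nothing and avoids choosing one; the right-hand side can be read as a formula.\<close>

lemma in_closure_all_charts:
  assumes "S \<subseteq> pts"
  shows "z \<in> space_top X closure_of S \<longleftrightarrow>
    z \<in> pts \<and> (\<forall>i\<in>chart_idx X. z \<in> chart_dom X i \<longrightarrow> (\<forall>u>0. \<exists>w\<in>S. w \<in> chart_ball i z u))"
  using in_closure_chart[OF assms] ex_chart[of z] closure_of_subset_topspace[of "space_top X" S] by blast

text \<open>A box is a priori closed only relative to its chart. The closed set \<open>N\<close>
  keeps limit points inside the chart, and there \<open>wclose\<close> survives limits in each
  coordinate.\<close>

lemma closed_chart_cball:
  assumes i: "i \<in> chart_idx X" and N: "closedin (space_top X) N" "N \<subseteq> chart_dom X i"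
    and sub: "chart_cball i x s \<subseteq> N"
  shows "closedin (space_top X) (chart_cball i x s)"
proof -
  have pts: "chart_cball i x s \<subseteq> pts" using N(1) sub closedin_subset by blast
  have "space_top X closure_of chart_cball i x s \<subseteq> chart_cball i x s"
  proof
    fix z assume z: "z \<in> space_top X closure_of chart_cball i x s"
    have "z \<in> N" using closure_of_minimal[OF sub N(1)] z by blast
    then have zU: "z \<in> chart_dom X i" using N by blast
    have "wclose s (crd i x k) (crd i z k)" if k: "k < chart_dim X i" for k
    proof (rule wclose_limit)
      fix u :: 'a assume "0 < u"
      then obtain w where "w \<in> chart_cball i x s" "w \<in> chart_ball i z u"
        using in_closure_chart[OF pts i zU] z by blast
      then show "\<exists>b. wclose s (crd i x k) b \<and> close u b (crd i z k)"
        using k by (auto simp: chart_cball_def chart_ball_def close_sym)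
    qed
    then show "z \<in> chart_cball i x s" using zU by (simp add: chart_cball_def)
  qed
  then show ?thesis using pts closure_of_subset_eq by blast
qed

lemma chart_cball_subset:
  assumes "\<And>k. k < chart_dim X i \<Longrightarrow> wclose d (crd i x k) (crd i y k)" "d + t \<le> s"
  shows "chart_cball i y t \<subseteq> chart_cball i x s"
  using assms by (auto simp: chart_cball_def dest!: wclose_trans[where t = t] intro: wclose_mono)

lemma ex_closed_chart_cball:
  assumes reg: "regular_space (space_top X)" and i: "i \<in> chart_idx X" and x: "x \<in> chart_dom X i"
  shows "\<exists>s>0. closedin (space_top X) (chart_cball i x s)"
proof -
  have "closedin (space_top X) (pts - chart_dom X i)" using open_dom[OF i] by blast
  moreover have "x \<in> pts - (pts - chart_dom X i)" using x dom_pts[OF i] by blast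
  ultimately obtain U V where UV: "openin (space_top X) U" "openin (space_top X) V" "x \<in> U"
      "pts - chart_dom X i \<subseteq> V" "disjnt U V"
    using reg unfolding regular_space_def by metis
  obtain s where s: "s > 0" "chart_ball i x s \<subseteq> U"
    using ex_chart_ball_subset[OF i x UV(3,1)] by blast
  obtain t where t: "t > 0" "t + t = s" using half[OF s(1)] by blast
  have "chart_cball i x t \<subseteq> chart_ball i x s"
    using t by (auto simp: chart_cball_def chart_ball_def intro: wclose_close)
  then have "chart_cball i x t \<subseteq> pts - V"
    using s UV(1,5) openin_subset unfolding disjnt_def by blast
  \<comment> \<open>The complement of \<open>V\<close> is the closed subset of the chart that
    \<open>closed_chart_cball\<close> asks for.\<close>
  then have "closedin (space_top X) (chart_cball i x t)"
    using UV by (intro closed_chart_cball[OF i, of "pts - V"]) auto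
  then show ?thesis using t by blast
qed

text \<open>Points of the space as values of vector variables: \<open>pt i a\<close> is the point with coordinates \<open>a\<close>
  in chart \<open>i\<close>, and some fixed point if there is none.\<close>

definition pt :: "'i \<Rightarrow> (nat \<Rightarrow> 'a) \<Rightarrow> 's" where
  "pt i a = (if restrict a {..<chart_dim X i} \<in> chart X i ` chart_dom X i
     then inv_into (chart_dom X i) (chart X i) (restrict a {..<chart_dim X i})
     else SOME x. x \<in> pts)"

lemma pt_restrict [simp]: "pt i (restrict a {..<chart_dim X i}) = pt i a"
  by (simp add: pt_def)

lemma pt_chart: "i \<in> chart_idx X \<Longrightarrow> x \<in> chart_dom X i \<Longrightarrow> pt i (chart X i x) = x"
  using chart_Mpow[of i x] inj_chart[of i] by (simp add: pt_def Mpow_def PiE_restrict)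

lemma pt_in_pts: "i \<in> chart_idx X \<Longrightarrow> pts \<noteq> {} \<Longrightarrow> pt i a \<in> pts"
  using some_in_eq[of pts] inv_into_into[of _ "chart X i" "chart_dom X i"] dom_pts[of i]
  by (auto simp: pt_def)

lemma def_pred_in_chart_dom:
  assumes i: "i \<in> chart_idx X" and j: "j \<in> chart_idx X"
    and F: "\<And>k. def_term M (\<lambda>e. F e k)"
  shows "def_pred M (\<lambda>e. pt i (F e) \<in> chart_dom X j)"
proof -
  let ?m = "chart_dim X i"
  have "definable M ?m {}"
    using definable_if_def_pred[OF def_pred_const, of M ?m False] by simp
  then have 1: "definable M ?m (chart X i ` (chart_dom X i \<inter> chart_dom X j))"
    using transition[OF i j] definable_codom[OF i]
    by (cases "i = j"; cases "chart_dom X i \<inter> chart_dom X j = {}") (simp_all add: definable_homeomorphism_def)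
  have "pt i (F e) \<in> chart_dom X j \<longleftrightarrow>
      (if restrict (F e) {..<?m} \<in> chart X i ` chart_dom X i
       then restrict (F e) {..<?m} \<in> chart X i ` (chart_dom X i \<inter> chart_dom X j)
       else (SOME x. x \<in> pts) \<in> chart_dom X j)" for e
    using inj_chart[OF i] by (auto simp: pt_def dest: inj_onD)
  moreover have "def_pred M (\<lambda>e. (if restrict (F e) {..<?m} \<in> chart X i ` chart_dom X i
       then restrict (F e) {..<?m} \<in> chart X i ` (chart_dom X i \<inter> chart_dom X j)
       else (SOME x. x \<in> pts) \<in> chart_dom X j))"
    by (intro def_pred_if def_pred_const def_pred_mem[OF definable_codom[OF i]] def_pred_mem[OF 1] F)
  ultimately show ?thesis by simp
qed

lemma def_pred_in_codom:
  assumes "i \<in> chart_idx X" "\<And>k. def_term M (\<lambda>e. F e k)"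
  shows "def_pred M (\<lambda>e. restrict (F e) {..<chart_dim X i} \<in> chart X i ` chart_dom X i)"
  by (intro def_pred_mem definable_codom assms)

text \<open>Change of coordinates is the identity for equal charts, given by the graph of the
  transition map for distinct overlapping ones, and constant otherwise. A vector outside the
  codomain denotes the default point of \<open>pt\<close>, whose coordinates are constants.\<close>

lemma def_term_crd:
  assumes i: "i \<in> chart_idx X" and j: "j \<in> chart_idx X"
    and F: "\<And>k. def_term M (\<lambda>e. F e k)"
  shows "def_term M (\<lambda>e. crd j (pt i (F e)) k)"
proof -
  let ?m = "chart_dim X i" and ?n = "chart_dim X j"
  let ?U = "chart_dom X i" and ?V = "chart_dom X j"
  consider (out) "\<not> k < ?n \<or> ?U \<inter> ?V = {}" | (same) "k < ?n" "i = j" | (diff) "i \<noteq> j" "?U \<inter> ?V \<noteq> {}" "k < ?n"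
    by blast
  then have "def_term M (\<lambda>e. if pt i (F e) \<in> ?V \<and> restrict (F e) {..<?m} \<in> chart X i ` ?U then crd j (pt i (F e)) k
       else 0)" (is "def_term M ?f")
  proof cases
    case out
    then have *: "?f e = 0" for e
      using inv_into_into[of "restrict (F e) {..<?m}" "chart X i" ?U]
      by (auto simp: crd_def pt_def)
    show ?thesis unfolding * by (rule def_term_const)
  next
    case same
    then have "?f e = (if restrict (F e) {..<?m} \<in> chart X i ` ?U then F e k else 0)" for e
      using f_inv_into_f[of "restrict (F e) {..<?m}" "chart X i" ?U]
        inv_into_into[of "restrict (F e) {..<?m}" "chart X i" ?U] by (auto simp: crd_def pt_def)
    moreover have "def_term M (\<lambda>e. if restrict (F e) {..<?m} \<in> chart X i ` ?U then F e k else 0)"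
      by (intro def_term_if def_pred_in_codom[OF i] F def_term_const)
    ultimately show ?thesis by simp
  next
    case diff
    let ?t = "chart X j \<circ> inv_into (?U \<inter> ?V) (chart X i)"
    let ?G = "(\<lambda>x. concat_pt ?m ?n x (?t x)) ` (chart X i ` (?U \<inter> ?V))"
    have G: "definable M (?m + ?n) ?G"
      using transition[OF i j diff(1,2)] by (simp add: definable_homeomorphism_def)
    \<comment> \<open>The vector \<open>b\<close> stands for the coordinates in chart
      \<open>j\<close>: appended to the value of \<open>F\<close>, it gives a point on the graph of
      the transition map.\<close>
    let ?Q = "\<lambda>e. if pt i (F (\<lambda>l. e (Suc l))) \<in> ?V \<and> restrict (F (\<lambda>l. e (Suc l))) {..<?m} \<in> chart X i ` ?U
        then \<exists>b. b k = e 0 0 \<and> restrict (\<lambda>l. if l < ?m then F (\<lambda>l. e (Suc l)) l else b (l - ?m)) {..<?m + ?n} \<in> ?G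
        else e 0 0 = 0"
    have F1: "def_term M (\<lambda>e. F (\<lambda>l. e (Suc l)) k)" for k
      by (rule def_term_shift[OF F])
    have F2: "def_term M (\<lambda>e. if l < ?m then F (\<lambda>l. e (Suc (Suc l))) l else e 0 (l - ?m))" for l
      using def_term_shift[OF F1] def_term_var by (cases "l < ?m") auto
    have "def_pred M ?Q"
      by (intro def_pred_if def_pred_conj def_pred_in_chart_dom[OF i j] def_pred_in_codom[OF i] F1
          def_pred_ex_vec def_pred_eq def_term_var def_term_const def_pred_mem[OF G] F2)
    moreover have "?Q e \<longleftrightarrow> e 0 0 = ?f (\<lambda>l. e (Suc l))" for e
    proof -
      define a where "a = F (\<lambda>l. e (Suc l))"
      show ?thesis
      proof (cases "pt i a \<in> ?V \<and> restrict a {..<?m} \<in> chart X i ` ?U")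
        case True
        define x where "x = pt i a"
        have x: "x \<in> ?U" "x \<in> ?V" "chart X i x = restrict a {..<?m}"
          using True f_inv_into_f[of "restrict a {..<?m}" "chart X i" ?U]
            inv_into_into[of "restrict a {..<?m}" "chart X i" ?U] by (auto simp: x_def pt_def)
        have inv: "inv_into (?U \<inter> ?V) (chart X i) (chart X i y) = y" if "y \<in> ?U" "y \<in> ?V" for y
          using that inj_chart[OF i] by (intro inv_into_f_f) (auto intro: inj_on_subset)
        have "(\<exists>b. b k = e 0 0 \<and> restrict (\<lambda>l. if l < ?m then a l else b (l - ?m)) {..<?m + ?n} \<in> ?G)
           \<longleftrightarrow> e 0 0 = chart X j x k" (is "?l \<longleftrightarrow> ?r")
        proof
          assume ?l
          then obtain b y where b: "b k = e 0 0" and y: "y \<in> ?U" "y \<in> ?V" and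
            eq: "restrict (\<lambda>l. if l < ?m then a l else b (l - ?m)) {..<?m + ?n} = concat_pt ?m ?n (chart X i y) (chart X j y)"
            using inv by auto
          have "a l = chart X i y l" if "l < ?m" for l
            using fun_cong[OF eq, of l] that by (simp add: concat_pt_def)
          then have "chart X i y = chart X i x"
            using chart_Mpow[OF i y(1)] unfolding x(3)
            by (intro ext) (auto simp: Mpow_def PiE_iff extensional_def)
          then have "y = x" using inj_onD[OF inj_chart[OF i]] x(1) y(1) by blast
          then show ?r using fun_cong[OF eq, of "?m + k"] diff(3) b by (simp add: concat_pt_def)
        next
          assume r: ?r
          have "restrict (\<lambda>l. if l < ?m then a l else chart X j x (l - ?m)) {..<?m + ?n}
             = concat_pt ?m ?n (chart X i x) (?t (chart X i x))"
            unfolding comp_apply inv[OF x(1,2)] by (intro ext) (simp add: concat_pt_def x(3))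
          then show ?l using r x(1,2) by (intro exI[of _ "chart X j x"]) auto
        qed
        moreover have "crd j (pt i a) k = chart X j x k" using x diff(3) by (simp add: crd_def x_def)
        ultimately show ?thesis using True unfolding a_def by simp
      next
        case False
        then show ?thesis by (auto simp: a_def)
      qed
    qed
    ultimately show ?thesis by (simp add: def_term_def)
  qed
  moreover have "crd j (pt i (F e)) k = (if restrict (F e) {..<?m} \<in> chart X i ` ?U then ?f e else crd j (SOME x. x \<in> pts) k)" for e
    by (auto simp: crd_def pt_def)
  moreover have "def_term M (\<lambda>e. if restrict (F e) {..<?m} \<in> chart X i ` ?U then ?f e else crd j (SOME x. x \<in> pts) k)"
    if "def_term M ?f"
    by (intro def_term_if[OF _ that] def_pred_in_codom[OF i] F def_term_const)
  ultimately show ?thesis by simp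
qed

text \<open>Every point is some \<open>pt i a\<close>, and \<open>pt\<close> never leaves a nonempty
  space, so a quantifier over points is a finite disjunction over charts of quantifiers over
  vectors.\<close>

lemma def_pred_ex_pts:
  assumes "\<And>i. i \<in> chart_idx X \<Longrightarrow> def_pred M (\<lambda>e. R (\<lambda>l. e (Suc l)) (pt i (e 0)))"
  shows "def_pred M (\<lambda>e. \<exists>x\<in>pts. R e x)"
proof (cases "pts = {}")
  case True
  then show ?thesis using def_pred_const by simp
next
  case False
  have "(\<exists>x\<in>pts. R e x) \<longleftrightarrow> (\<exists>i\<in>chart_idx X. \<exists>a. R e (pt i a))" for e
    using False pt_in_pts pt_chart ex_chart by metis
  moreover have "def_pred M (\<lambda>e. \<exists>i\<in>chart_idx X. \<exists>a. R e (pt i a))"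
    by (intro def_pred_bex_finite[OF fin_idx] def_pred_ex_vec assms)
  ultimately show ?thesis by simp
qed

lemma def_pred_all_pts:
  assumes "\<And>i. i \<in> chart_idx X \<Longrightarrow> def_pred M (\<lambda>e. R (\<lambda>l. e (Suc l)) (pt i (e 0)))"
  shows "def_pred M (\<lambda>e. \<forall>x\<in>pts. R e x)"
  using def_pred_not[OF def_pred_ex_pts[of "\<lambda>e x. \<not> R e x"]] def_pred_not[OF assms] by simp

lemma definable_in_if_def_pred:
  assumes "S \<subseteq> pts" "\<And>i. i \<in> chart_idx X \<Longrightarrow> def_pred M (\<lambda>e. pt i (e 0) \<in> S)"
  shows "definable_in M X S"
  unfolding definable_in_def
proof (intro conjI ballI assms(1))
  fix i assume i: "i \<in> chart_idx X"
  have "chart X i ` (S \<inter> chart_dom X i) = {a \<in> Mpow (chart_dim X i). a \<in> chart X i ` chart_dom X i \<and> pt i a \<in> S}"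
    using pt_chart[OF i] chart_Mpow[OF i] by auto
  moreover have "def_pred M (\<lambda>e. restrict (e 0) {..<chart_dim X i} \<in> chart X i ` chart_dom X i \<and>
      pt i (restrict (e 0) {..<chart_dim X i}) \<in> S)"
    unfolding pt_restrict by (intro def_pred_conj def_pred_in_codom def_term_var assms i)
  ultimately show "definable M (chart_dim X i) (chart X i ` (S \<inter> chart_dom X i))"
    using definable_if_def_pred[where Q = "\<lambda>a. a \<in> chart X i ` chart_dom X i \<and> pt i a \<in> S"] by (simp del: pt_restrict)
qed

end

section \<open>Definable compactness\<close>

lemma homeomorphic_map_snd_singleton:
  "homeomorphic_map (prod_topology (discrete_topology {a}) Y) Y snd"
  by (simp add: homeomorphic_map_def inj_on_def)
    (metis insert_not_empty null_topspace_iff_trivial topspace_discrete_topology)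

lemma definable_subset_Mpow: "definable M n D \<Longrightarrow> D \<subseteq> Mpow n"
  by (auto simp: definable_def)

lemma restrict_Mpow: "t \<in> Mpow n \<Longrightarrow> restrict t {..<n} = t"
  by (simp add: Mpow_def PiE_restrict)

context pd_space
begin

text \<open>The parameter set \<open>D\<close> becomes the one-chart space
  \<open>{0} \<times> D\<close> with chart \<open>snd\<close>, which has the point type over which
  \<open>definably_compact\<close> quantifies. The uniform assumption on \<open>C\<close> yields
  definability of each fibre and of the total set by substitution.\<close>

lemma definably_compact_Inter:
  assumes compact: "definably_compact M X" and D: "definable M n D"
    and C: "\<And>i. i \<in> chart_idx X \<Longrightarrow> def_pred M (\<lambda>e. pt i (e 0) \<in> C (restrict (e 1) {..<n}))"
    and closed: "\<And>t. t \<in> D \<Longrightarrow> closedin (space_top X) (C t)" and ne: "\<And>t. t \<in> D \<Longrightarrow> C t \<noteq> {}"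
    and filt: "\<And>t t'. t \<in> D \<Longrightarrow> t' \<in> D \<Longrightarrow> \<exists>t''\<in>D. C t'' \<subseteq> C t \<inter> C t'"
  shows "(\<Inter>t\<in>D. C t) \<noteq> {}"
proof -
  define T :: "(nat \<times> (nat \<Rightarrow> 'a), nat, 'a) atlas_space" where
    "T = \<lparr>space_top = prod_topology (discrete_topology {0}) (subtopology (Mpow_top n) D),
      chart_idx = {0}, chart_dom = (\<lambda>_. {0} \<times> D), chart_dim = (\<lambda>_. n), chart = (\<lambda>_. snd)\<rparr>"
  have DM: "D \<subseteq> Mpow n" using D by (rule definable_subset_Mpow)
  have T: "topspace (space_top T) = {0} \<times> D"
    using DM by (auto simp: T_def topspace_Mpow_top)
  have "pseudo_definable_space M T"
  proof -
    have "openin (space_top T) ({0} \<times> D)" using T openin_topspace by metis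
    moreover have "subtopology (space_top T) ({0} \<times> D) = space_top T" using T subtopology_topspace by metis
    ultimately show ?thesis
      using D T unfolding pseudo_definable_space_def
      by (simp add: T_def homeomorphic_map_snd_singleton)
  qed
  moreover have "definable_filtered_collection M T X (\<lambda>t. C (snd t))"
    unfolding definable_filtered_collection_def definable_family_def
  proof (intro conjI ballI)
    fix t assume t: "t \<in> topspace (space_top T)"
    have tD: "snd t \<in> D" using t unfolding T by auto
    show "definable_in M X (C (snd t))"
    proof (rule definable_in_if_def_pred)
      show "C (snd t) \<subseteq> pts" using closed[OF tD] closedin_subset by blast
      fix i assume i: "i \<in> chart_idx X"
      have "def_term M (\<lambda>e. if v = (0::nat) then e 0 k else snd t k)" for v k
        by (cases "v = 0") (simp_all add: def_term_var def_term_const)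
      from def_pred_subst[OF C[OF i], of "\<lambda>e v k. if v = 0 then e 0 k else snd t k", OF this]
      show "def_pred M (\<lambda>e. pt i (e 0) \<in> C (snd t))"
        by (simp add: restrict_Mpow[OF subsetD[OF DM tD]])
    qed
  next
    show "definable_in M (prod_space T X) (SIGMA t:topspace (space_top T). C (snd t))"
      unfolding definable_in_def
    proof (intro conjI ballI)
      show "(SIGMA t:topspace (space_top T). C (snd t)) \<subseteq> topspace (space_top (prod_space T X))"
        using closed closedin_subset T by (fastforce simp: prod_space_def)
      fix p assume "p \<in> chart_idx (prod_space T X)"
      then obtain i where p: "p = (0, i)" and i: "i \<in> chart_idx X"
        by (auto simp: prod_space_def T_def)
      let ?m = "chart_dim X i"
      \<comment> \<open>The first \<open>n\<close> entries are the parameter, the remaining ones the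
        chart coordinates of a point in its fibre.\<close>
      let ?Q = "\<lambda>y. restrict y {..<n} \<in> D \<and> restrict (\<lambda>k. y (n + k)) {..<?m} \<in> chart X i ` chart_dom X i
          \<and> pt i (\<lambda>k. y (n + k)) \<in> C (restrict y {..<n})"
      have eq: "chart (prod_space T X) p ` ((SIGMA t:topspace (space_top T). C (snd t)) \<inter> chart_dom (prod_space T X) p)
        = {y \<in> Mpow (n + ?m). ?Q y}" (is "?L = ?R")
      proof (intro equalityI subsetI)
        fix y assume "y \<in> ?L"
        then obtain t x where tx: "t \<in> D" "x \<in> C t" "x \<in> chart_dom X i" "y = concat_pt n ?m t (chart X i x)"
          unfolding p T by (auto simp: prod_space_def T_def)
        have "restrict y {..<n} = t" using subsetD[OF DM tx(1)] unfolding tx(4)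
          by (intro ext) (auto simp: concat_pt_def Mpow_def PiE_iff extensional_def)
        moreover have yk: "restrict (\<lambda>k. y (n + k)) {..<?m} = chart X i x"
          using chart_Mpow[OF i tx(3)] unfolding tx(4)
          by (intro ext) (auto simp: concat_pt_def Mpow_def PiE_iff extensional_def)
        moreover have "pt i (\<lambda>k. y (n + k)) = x"
          using pt_chart[OF i tx(3)] yk pt_restrict by metis
        moreover have "y \<in> Mpow (n + ?m)" unfolding tx(4) by (simp add: concat_pt_def Mpow_def)
        ultimately show "y \<in> ?R" using tx by auto
      next
        fix y assume y: "y \<in> ?R"
        then obtain x where x: "x \<in> chart_dom X i" "restrict (\<lambda>k. y (n + k)) {..<?m} = chart X i x"
          by auto
        then have "pt i (\<lambda>k. y (n + k)) = x" using pt_chart[OF i x(1)] pt_restrict by metis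
        then have "x \<in> C (restrict y {..<n})" using y by auto
        moreover have "y = concat_pt n ?m (restrict y {..<n}) (chart X i x)"
          using y unfolding x(2)[symmetric]
          by (intro ext) (auto simp: concat_pt_def Mpow_def PiE_iff extensional_def)
        ultimately have "y \<in> (\<lambda>(t, x). concat_pt n ?m (snd t) (chart X i x)) `
            ((SIGMA t:{0} \<times> D. C (snd t)) \<inter> ({0::nat} \<times> D) \<times> chart_dom X i)"
          using y x(1) by (intro image_eqI[of _ _ "((0, restrict y {..<n}), x)"]) auto
        then show "y \<in> ?L" unfolding p T by (simp add: prod_space_def T_def)
      qed
      have "def_term M (\<lambda>e. if v = (0::nat) then e 0 (n + k) else e 0 k)" for v k
        by (cases "v = 0") (simp_all add: def_term_var)
      from def_pred_subst[OF C[OF i], of "\<lambda>e v k. if v = 0 then e 0 (n + k) else e 0 k", OF this]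
      have "def_pred M (\<lambda>e. pt i (\<lambda>k. e 0 (n + k)) \<in> C (restrict (e 0) {..<n}))" by simp
      then have "def_pred M (\<lambda>e. restrict (e 0) {..<n} \<in> D \<and>
          restrict (\<lambda>k. e 0 (n + k)) {..<?m} \<in> chart X i ` chart_dom X i \<and>
          pt i (\<lambda>k. e 0 (n + k)) \<in> C (restrict (e 0) {..<n}))"
        by (intro def_pred_conj def_pred_in_codom def_pred_mem[OF D] def_term_var i)
      moreover have "?Q (restrict y {..<n + ?m}) \<longleftrightarrow> ?Q y" for y
      proof -
        have "restrict (restrict y {..<n + ?m}) {..<n} = restrict y {..<n}" by auto
        moreover have *: "restrict (\<lambda>k. restrict y {..<n + ?m} (n + k)) {..<?m} = restrict (\<lambda>k. y (n + k)) {..<?m}"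
          by auto
        moreover have "pt i (\<lambda>k. restrict y {..<n + ?m} (n + k)) = pt i (\<lambda>k. y (n + k))"
          using * pt_restrict by metis
        ultimately show ?thesis by presburger
      qed
      ultimately have "definable M (n + ?m) {y \<in> Mpow (n + ?m). ?Q y}"
        by (intro definable_if_def_pred) simp
      then show "definable M (chart_dim (prod_space T X) p) (chart (prod_space T X) p `
          ((SIGMA t:topspace (space_top T). C (snd t)) \<inter> chart_dom (prod_space T X) p))"
        unfolding eq by (simp add: p prod_space_def T_def)
    qed
  next
    show "filtered_collection ((\<lambda>t. C (snd t)) ` topspace (space_top T))"
      using filt unfolding filtered_collection_def T by fastforce
  qed
  moreover have "\<forall>t\<in>topspace (space_top T). closedin (space_top X) (C (snd t)) \<and> C (snd t) \<noteq> {}"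
    using closed ne T by auto
  ultimately have "(\<Inter>t\<in>topspace (space_top T). C (snd t)) \<noteq> {}"
    using compact unfolding definably_compact_def by blast
  moreover have "(\<Inter>t\<in>{0::nat} \<times> D. C (snd t)) = (\<Inter>t\<in>D. C t)" by force
  ultimately show ?thesis unfolding T by simp
qed

definition tame :: "'i \<Rightarrow> 's \<Rightarrow> 'a \<Rightarrow> 'a \<Rightarrow> bool" where
  "tame i x s K \<longleftrightarrow> x \<in> chart_dom X i \<and> closedin (space_top X) (chart_cball i x s) \<and>
     (\<forall>k<chart_dim X i. wclose K (crd i x k) 0)"

text \<open>Moving the centre by \<open>d\<close> costs \<open>d\<close> both in the radius and in
  the coordinate bound. The new box lies in the old one, which serves as the closed set within the
  chart.\<close>

lemma tame_mono:
  assumes i: "i \<in> chart_idx X" and x: "tame i x s K" and y: "y \<in> chart_dom X i"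
    and d: "\<And>k. k < chart_dim X i \<Longrightarrow> wclose d (crd i x k) (crd i y k)" "d + t \<le> s" "d + K \<le> L"
  shows "tame i y t L"
proof -
  have sub: "chart_cball i y t \<subseteq> chart_cball i x s" by (rule chart_cball_subset[OF d(1,2)])
  have "closedin (space_top X) (chart_cball i y t)"
    by (rule closed_chart_cball[OF i _ _ sub]) (use x in \<open>auto simp: tame_def chart_cball_def\<close>)
  moreover have "wclose L (crd i y k) 0" if k: "k < chart_dim X i" for k
  proof -
    have "wclose d (crd i y k) (crd i x k)" "wclose K (crd i x k) 0"
      using d(1)[OF k] x k by (simp_all add: tame_def wclose_sym[of d])
    then have "wclose (d + K) (crd i y k) 0" by (rule wclose_trans)
    then show ?thesis using d(3) by (rule wclose_mono)
  qed
  ultimately show ?thesis using y by (simp add: tame_def)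
qed

lemma def_pred_close:
  "def_term M f \<Longrightarrow> def_term M g \<Longrightarrow> def_term M h \<Longrightarrow> def_pred M (\<lambda>e. close (f e) (g e) (h e))"
  unfolding close_def by (intro def_pred_conj def_pred_less def_term_add)

lemma def_pred_wclose:
  "def_term M f \<Longrightarrow> def_term M g \<Longrightarrow> def_term M h \<Longrightarrow> def_pred M (\<lambda>e. wclose (f e) (g e) (h e))"
  unfolding wclose_def by (intro def_pred_conj def_pred_le def_term_add)

text \<open>Closedness in first-order form, as needed for \<open>def_pred_tame\<close>: a point that
  is adherent to the box, tested in each of its charts, belongs to the box.\<close>

lemma tame_iff:
  assumes i: "i \<in> chart_idx X"
  shows "tame i x s K \<longleftrightarrow> x \<in> chart_dom X i \<and> (\<forall>k<chart_dim X i. wclose K (crd i x k) 0) \<and>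
    (\<forall>z\<in>pts. (\<forall>j\<in>chart_idx X. z \<in> chart_dom X j \<longrightarrow> (\<forall>u. 0 < u \<longrightarrow>
        (\<exists>w\<in>pts. w \<in> chart_dom X i \<and> (\<forall>k<chart_dim X i. wclose s (crd i x k) (crd i w k)) \<and>
           w \<in> chart_dom X j \<and> (\<forall>k<chart_dim X j. close u (crd j z k) (crd j w k))))) \<longrightarrow>
      z \<in> chart_dom X i \<and> (\<forall>k<chart_dim X i. wclose s (crd i x k) (crd i z k)))"
proof -
  have sub: "chart_cball i x s \<subseteq> pts" using dom_pts[OF i] by (auto simp: chart_cball_def)
  have "closedin (space_top X) (chart_cball i x s) \<longleftrightarrow>
    (\<forall>z\<in>pts. (\<forall>j\<in>chart_idx X. z \<in> chart_dom X j \<longrightarrow> (\<forall>u>0. \<exists>w\<in>chart_cball i x s. w \<in> chart_ball j z u)) \<longrightarrow>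
       z \<in> chart_cball i x s)"
    unfolding closure_of_subset_eq[symmetric] using sub in_closure_all_charts[OF sub] by blast
  moreover have "(\<exists>w\<in>chart_cball i x s. w \<in> chart_ball j z u) \<longleftrightarrow>
      (\<exists>w\<in>pts. w \<in> chart_dom X i \<and> (\<forall>k<chart_dim X i. wclose s (crd i x k) (crd i w k)) \<and>
           w \<in> chart_dom X j \<and> (\<forall>k<chart_dim X j. close u (crd j z k) (crd j w k)))" for j z u
    using dom_pts[OF i] by (auto simp: chart_cball_def chart_ball_def)
  moreover have "z \<in> chart_cball i x s \<longleftrightarrow> z \<in> chart_dom X i \<and> (\<forall>k<chart_dim X i. wclose s (crd i x k) (crd i z k))" for z
    by (auto simp: chart_cball_def)
  ultimately show ?thesis unfolding tame_def by (simp only: conj_ac)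
qed

lemma def_pred_tame:
  assumes i: "i \<in> chart_idx X" and j: "j \<in> chart_idx X"
    and F: "\<And>k. def_term M (\<lambda>e. F e k)" and s: "def_term M s" and K: "def_term M K"
  shows "def_pred M (\<lambda>e. tame i (pt j (F e)) (s e) (K e))"
proof -
  \<comment> \<open>Plain variables come first, with radius and bound in coordinates 0 and 1 of
    index 1; arbitrary terms are substituted afterwards.\<close>
  have base: "def_pred M (\<lambda>e. tame i (pt j (e 0)) (e 1 0) (e 1 1))"
    unfolding tame_iff[OF i]
    by (intro def_pred_conj def_pred_imp def_pred_all_less def_pred_ball_finite[OF fin_idx] def_pred_all
        def_pred_all_pts def_pred_ex_pts def_pred_in_chart_dom def_term_crd def_pred_close def_pred_wclose
        def_pred_less def_term_var def_term_const i j)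
  have "def_term M (\<lambda>e. if v = (0::nat) then F e k else if k = 0 then s e else K e)" for v k
    using F s K by (cases "v = 0"; cases "k = 0") simp_all
  from def_pred_subst[OF base, of "\<lambda>e v k. if v = 0 then F e k else if k = 0 then s e else K e", OF this]
  show ?thesis by simp
qed

text \<open>Otherwise the closures of the bad sets \<open>A r K\<close> have a common point
  \<open>z\<close>. By regularity \<open>z\<close> is tame in some chart with some radius
  \<open>s\<close> and bound \<open>K\<close>, so all points within \<open>s / 2\<close> of it in
  that chart are tame with radius \<open>s / 2\<close> and bound \<open>s / 2 + K\<close>. But a
  point that is bad for these values lies that close.\<close>

lemma uniformly_tame:
  assumes reg: "regular_space (space_top X)" and compact: "definably_compact M X"
  shows "\<exists>r>0. \<exists>K>0. \<forall>x\<in>pts. \<exists>i\<in>chart_idx X. tame i x r K"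
proof (rule ccontr)
  assume contra: "\<not> ?thesis"
  define A where "A r K = {x \<in> pts. \<forall>i\<in>chart_idx X. \<not> tame i x r K}" for r K
  define C where "C t = space_top X closure_of A (t 0) (t 1)" for t :: "nat \<Rightarrow> 'a"
  define D where "D = {t \<in> Mpow 2. 0 < (t 0 :: 'a) \<and> 0 < t 1}"
  have D: "definable M 2 D" unfolding D_def
    by (rule definable_if_def_pred) (simp, intro def_pred_conj def_pred_less def_term_var def_term_const)
  have A_sub: "A r K \<subseteq> pts" for r K by (auto simp: A_def)
  have A_mono: "A r K \<subseteq> A r' K'" if "r \<le> r'" "K' \<le> K" for r K r' K'
  proof -
    have "tame i x r K" if "i \<in> chart_idx X" "tame i x r' K'" for i x
      by (rule tame_mono[OF that, of _ 0])
        (use that \<open>r \<le> r'\<close> \<open>K' \<le> K\<close> in \<open>simp_all add: tame_def wclose_refl\<close>)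
    then show ?thesis unfolding A_def by blast
  qed
  have "(\<Inter>t\<in>D. C t) \<noteq> {}"
  proof (rule definably_compact_Inter[OF compact D])
    fix i assume i: "i \<in> chart_idx X"
    have C_iff: "z \<in> C t \<longleftrightarrow> z \<in> pts \<and> (\<forall>i\<in>chart_idx X. z \<in> chart_dom X i \<longrightarrow>
       (\<forall>u. 0 < u \<longrightarrow> (\<exists>w\<in>pts. (\<forall>i\<in>chart_idx X. \<not> tame i w (t 0) (t 1)) \<and> w \<in> chart_dom X i \<and>
          (\<forall>k<chart_dim X i. close u (crd i z k) (crd i w k)))))" for z t
      unfolding C_def in_closure_all_charts[OF A_sub]
      unfolding A_def chart_ball_def by (simp add: Bex_def conj_ac)
    have r: "restrict t {..<2} 0 = t 0" "restrict t {..<2} 1 = t 1" for t :: "nat \<Rightarrow> 'a" by auto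
    show "def_pred M (\<lambda>e. pt i (e 0) \<in> C (restrict (e 1) {..<2}))"
    \<comment> \<open>\<open>pt\<close> is known to denote a point of the space only if the space is
      nonempty.\<close>
    proof (cases "pts = {}")
      case True
      then show ?thesis unfolding C_iff by (simp add: def_pred_const)
    next
      case False
      then show ?thesis
        unfolding C_iff r using pt_in_pts[OF i]
        by (simp, intro def_pred_conj def_pred_imp def_pred_all_less def_pred_ball_finite[OF fin_idx] def_pred_all
          def_pred_ex_pts def_pred_in_chart_dom def_term_crd def_pred_close def_pred_not def_pred_tame
          def_pred_less def_term_var def_term_const i)
    qed
  next
    fix t assume "t \<in> D"
    show "closedin (space_top X) (C t)" by (simp add: C_def)
    have "A (t 0) (t 1) \<noteq> {}" using contra \<open>t \<in> D\<close> unfolding A_def D_def by blast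
    then show "C t \<noteq> {}" using closure_of_subset[OF A_sub] unfolding C_def by blast
  next
    fix t t' assume t: "t \<in> D" "t' \<in> D"
    \<comment> \<open>\<open>A\<close> grows with the radius and shrinks as the bound grows, so the
      smaller radius and the larger bound give a set inside both.\<close>
    define t'' where "t'' = restrict (\<lambda>k. if k = 0 then min (t 0) (t' 0) else max (t 1) (t' 1)) {..<2::nat}"
    have "t'' \<in> D" using t unfolding D_def t''_def by (auto simp: Mpow_def less_max_iff_disj)
    moreover have "C t'' \<subseteq> C t \<inter> C t'"
      unfolding C_def t''_def by (intro Int_greatest closure_of_mono A_mono) auto
    ultimately show "\<exists>t''\<in>D. C t'' \<subseteq> C t \<inter> C t'" by blast
  qed
  then obtain z where z: "\<And>t. t \<in> D \<Longrightarrow> z \<in> C t" by blast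
  obtain e :: 'a where e: "0 < e" using ex_pos by blast
  have zC: "z \<in> space_top X closure_of A r K" if "0 < r" "0 < K" for r K
    using z[of "restrict (\<lambda>k. if k = 0 then r else K) {..<2}"] that by (auto simp: C_def D_def Mpow_def)
  then have "z \<in> pts" using e closure_of_subset_topspace by fastforce
  then obtain i where i: "i \<in> chart_idx X" "z \<in> chart_dom X i" using ex_chart by blast
  obtain s where s: "s > 0" "closedin (space_top X) (chart_cball i z s)"
    using ex_closed_chart_cball[OF reg i] by blast
  obtain t where t: "t > 0" "t + t = s" using half[OF s(1)] by blast
  obtain K where K: "K \<ge> e" "\<forall>k<chart_dim X i. max (crd i z k) (- crd i z k) \<le> K"
    using ex_bound_all_less[of e "chart_dim X i" "\<lambda>k. max (crd i z k) (- crd i z k)"] by blast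
  then have zK: "tame i z s K"
    using i(2) s(2) by (simp add: tame_def wclose_zeroI)
  have "0 < t + K" using t(1) K(1) e by (meson add_pos_pos less_le_trans)
  then obtain w where w: "w \<in> A t (t + K)" "w \<in> chart_ball i z t"
    using in_closure_chart[OF A_sub i] zC t(1) by blast
  then have "tame i w t (t + K)"
    using t(2) by (intro tame_mono[OF i(1) zK, of _ t]) (auto simp: chart_ball_def close_wclose)
  then show False using w(1) i(1) by (auto simp: A_def)
qed

end

section \<open>The radius of tameness\<close>

text \<open>Suprema are available only for definable sets. This predicate is first-order, so it also
  describes the graph of the radius function.\<close>

definition is_lub :: "'a::linorder set \<Rightarrow> 'a \<Rightarrow> bool" where
  "is_lub S v \<longleftrightarrow> (\<forall>s. s \<in> S \<longrightarrow> s \<le> v) \<and> (\<forall>u. (\<forall>s. s \<in> S \<longrightarrow> s \<le> u) \<longrightarrow> v \<le> u)"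

lemma is_lub_unique: "is_lub S v \<Longrightarrow> is_lub S w \<Longrightarrow> v = w"
  unfolding is_lub_def by (meson order_antisym)

lemma is_lubD: "is_lub S v \<Longrightarrow> s \<in> S \<Longrightarrow> s \<le> v"
  unfolding is_lub_def by blast

lemma is_lub_least: "is_lub S v \<Longrightarrow> (\<And>s. s \<in> S \<Longrightarrow> s \<le> u) \<Longrightarrow> v \<le> u"
  unfolding is_lub_def by blast

lemma ex_is_lub:
  assumes dc: "definably_complete M" and S: "def_pred M (\<lambda>e. e 0 0 \<in> S)"
    and ne: "a \<in> S" and bdd: "\<And>s. s \<in> S \<Longrightarrow> s \<le> b"
  shows "\<exists>v. is_lub S v"
proof -
  have "definable M 1 {x \<in> Mpow 1. x 0 \<in> S}"
    by (rule definable_if_def_pred) (simp add: S)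
  then obtain v where "isLub UNIV (Fin ` S) v"
    using dc unfolding definably_complete_def definable1_def by blast
  then have ub: "\<And>s. s \<in> S \<Longrightarrow> Fin s \<le> v" and least: "\<And>w. (\<And>s. s \<in> S \<Longrightarrow> Fin s \<le> w) \<Longrightarrow> v \<le> w"
    by (auto simp: isLub_def leastP_def isUb_def setle_def setge_def)
  \<comment> \<open>A member and an upper bound rule out both infinite values.\<close>
  have "v \<le> Fin b" using bdd by (intro least) simp
  moreover have "Fin a \<le> v" using ne by (rule ub)
  ultimately obtain c where c: "v = Fin c" by (cases v) auto
  have "is_lub S c"
    unfolding is_lub_def using ub least[of "Fin _"] by (auto simp: c)
  then show ?thesis ..
qed

context pd_space
begin

text \<open>It suffices to trap points arbitrarily close to \<open>z\<close> in a single tame box of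
  radius \<open>\<delta>\<close>, because that box is closed and lies in chart \<open>i\<close>. For
  this, their coordinates in chart \<open>i\<close> are localised around one vector \<open>p\<close>
  with error \<open>d\<close>, half of \<open>\<delta>\<close>.\<close>

lemma tame_closure:
  assumes dc: "definably_complete M" and i: "i \<in> chart_idx X" and j: "j \<in> chart_idx X"
    and z: "z \<in> chart_dom X j" and \<delta>: "0 < \<delta>"
    and ex: "\<And>u. 0 < u \<Longrightarrow> \<exists>y\<in>chart_ball j z u. tame i y \<delta> K"
  shows "z \<in> chart_dom X i"
proof -
  obtain d where d: "d > 0" "d + d = \<delta>" using half[OF \<delta>] by blast
  define F where "F l p u y \<longleftrightarrow> tame i y \<delta> K \<and> (y \<in> chart_dom X j \<and> (\<forall>k<chart_dim X j. close u (crd j z k) (crd j y k)))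
      \<and> (\<forall>k<l. close d (p k) (crd i y k))" for l p u y
  have F_pts: "y \<in> pts" if "F l p u y" for l p u y
    using that dom_pts[OF j] by (simp add: F_def)
  have F_mono: "F l p u y" if "F l p t y" "t \<le> u" for l p u t y
    using that by (auto simp: F_def intro: close_mono)
  \<comment> \<open>Definable completeness as a substitute for compactness of boxes: coordinate by coordinate, the
    supremum of the lower bounds of shrinking sets gives \<open>p\<close>, up to the fixed error \<open>d\<close>.\<close>
  have "\<exists>p. \<forall>u>0. \<exists>y. F l p u y" if "l \<le> chart_dim X i" for l
    using that
  proof (induction l)
    case 0
    then show ?case using ex by (auto simp: F_def chart_ball_def)
  next
    case (Suc l)
    then obtain p where p: "\<And>u. 0 < u \<Longrightarrow> \<exists>y. F l p u y" by (auto simp: Suc_le_eq)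
    have l: "l < chart_dim X i" using Suc.prems by simp
    \<comment> \<open>\<open>E\<close> collects the eventual lower bounds of coordinate
      \<open>l\<close> as \<open>y\<close> tends to \<open>z\<close>, so its supremum is a lower
      limit. The bound \<open>K\<close> from tameness makes \<open>E\<close> nonempty and bounded
      above.\<close>
    define E where "E = {x. \<exists>u. 0 < u \<and> (\<forall>y\<in>pts. F l p u y \<longrightarrow> x \<le> crd i y l)}"
    have bound: "crd i y l \<le> K" "- K \<le> crd i y l" if "F l p u y" for u y
    proof -
      have *: "crd i y l \<le> 0 + K" "0 \<le> crd i y l + K"
        using that l unfolding F_def tame_def wclose_def by blast+
      show "crd i y l \<le> K" using *(1) by simp
      show "- K \<le> crd i y l" using add_right_mono[OF *(2), of "- K"] by simp
    qed
    have "def_pred M (\<lambda>e. \<exists>u. 0 < u \<and> (\<forall>y\<in>pts. F l p u y \<longrightarrow> e 0 0 \<le> crd i y l))"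
      unfolding F_def
      by (intro def_pred_conj def_pred_imp def_pred_all_less def_pred_ex
        def_pred_all_pts def_pred_in_chart_dom def_term_crd def_pred_close def_pred_tame
        def_pred_less def_pred_le def_term_var def_term_const i j)
    then have E_def_pred: "def_pred M (\<lambda>e. e 0 0 \<in> E)" unfolding E_def by simp
    have "- K \<in> E"
      unfolding E_def using \<delta> bound(2) by blast
    moreover have E_le: "x \<le> K" if "x \<in> E" for x
    proof -
      obtain u where "0 < u" "\<forall>y\<in>pts. F l p u y \<longrightarrow> x \<le> crd i y l" using \<open>x \<in> E\<close> unfolding E_def by blast
      then show ?thesis using p F_pts bound(1) by (meson order_trans)
    qed
    ultimately obtain v where v: "is_lub E v"
      using ex_is_lub[OF dc E_def_pred] by blast
    have "v - d < v" using d(1) by simp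
    then obtain x where x: "x \<in> E" "v - d < x"
      using is_lub_least[OF v, of "v - d"] by (meson not_le)
    obtain u0 where u0: "0 < u0" "\<And>y. y \<in> pts \<Longrightarrow> F l p u0 y \<Longrightarrow> x \<le> crd i y l"
      using x(1) unfolding E_def by blast
    have "\<exists>y. F (Suc l) (p(l := v)) u y" if u: "0 < u" for u
    proof -
      \<comment> \<open>\<open>t\<close> respects both the requested nearness \<open>u\<close> and
        the radius \<open>u0\<close> within which \<open>x\<close> is a lower bound.\<close>
      define t where "t = min u u0"
      have t: "0 < t" "t \<le> u" "t \<le> u0" using u u0(1) by (auto simp: t_def)
      have "\<exists>y. F l p t y \<and> crd i y l < v + d"
      proof (rule ccontr)
        assume "\<not> ?thesis"
        then have "v + d \<in> E" unfolding E_def using t(1) by (auto simp: not_less)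
        then have "v + d \<le> v" by (rule is_lubD[OF v])
        then show False using d(1) by simp
      qed
      then obtain y where y: "F l p t y" "crd i y l < v + d" by blast
      have "x \<le> crd i y l" using u0(2) F_pts F_mono y(1) t(3) by blast
      then have "v - d < crd i y l" using x(2) by (rule less_le_trans[rotated])
      then have "close d v (crd i y l)" using y(2) by (simp add: close_def diff_less_eq)
      then have "F (Suc l) (p(l := v)) t y" using y(1) by (simp add: F_def less_Suc_eq)
      then show ?thesis using F_mono t(2) by blast
    qed
    then show ?case by blast
  qed
  then obtain p where p: "\<And>u. 0 < u \<Longrightarrow> \<exists>y. F (chart_dim X i) p u y" by blast
  \<comment> \<open>Any candidate can serve as centre: two of them differ by less than
    \<open>d + d\<close> in every coordinate.\<close>
  obtain y0 where y0: "F (chart_dim X i) p \<delta> y0" using p[OF \<delta>] by blast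
  let ?N = "chart_cball i y0 \<delta>"
  have N: "closedin (space_top X) ?N" "?N \<subseteq> chart_dom X i"
    using y0 by (auto simp: F_def tame_def chart_cball_def)
  have "\<exists>w\<in>?N. w \<in> chart_ball j z u" if u: "0 < u" for u
  proof -
    obtain y where y: "F (chart_dim X i) p u y" using p[OF u] by blast
    have "wclose \<delta> (crd i y0 k) (crd i y k)" if "k < chart_dim X i" for k
    proof -
      have "close d (crd i y0 k) (p k)" "close d (p k) (crd i y k)"
        using y y0 that by (simp_all add: F_def close_sym[of d "crd i y0 k"])
      then show ?thesis using close_trans d(2) close_wclose by metis
    qed
    then have "y \<in> ?N" using y by (simp add: chart_cball_def F_def tame_def)
    then show ?thesis using y by (auto simp: F_def chart_ball_def)
  qed
  then have "z \<in> space_top X closure_of ?N"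
    using in_closure_chart[OF closedin_subset[OF N(1)] j z] by blast
  then show ?thesis using N closure_of_closedin by blast
qed

text \<open>The nonpositive numbers make the set nonempty and give radius \<open>0\<close> outside the chart. The bound
  \<open>L - s\<close>, which grows as \<open>s\<close> shrinks, makes the radius Lipschitz.\<close>

definition tame_radii :: "'a \<Rightarrow> 'a \<Rightarrow> 'i \<Rightarrow> 's \<Rightarrow> 'a set" where
  "tame_radii r L i y = {s. s \<le> 0 \<or> (s \<le> r \<and> tame i y s (L - s))}"

definition tame_radius :: "'a \<Rightarrow> 'a \<Rightarrow> 'i \<Rightarrow> 's \<Rightarrow> 'a" where
  "tame_radius r L i y = (THE v. is_lub (tame_radii r L i y) v)"

lemma def_pred_tame_radii:
  assumes "i \<in> chart_idx X" "j \<in> chart_idx X" "\<And>k. def_term M (\<lambda>e. F e k)" "def_term M s"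
  shows "def_pred M (\<lambda>e. s e \<in> tame_radii r L i (pt j (F e)))"
  unfolding tame_radii_def mem_Collect_eq
  by (intro def_pred_disj def_pred_conj def_pred_le def_pred_tame def_term_diff def_term_const assms)

context
  fixes r L :: 'a
  assumes dc: "definably_complete M" and r: "0 < r"
begin

lemma tame_radius_lub:
  assumes i: "i \<in> chart_idx X"
  shows "is_lub (tame_radii r L i y) (tame_radius r L i y)"
proof -
  have "\<exists>v. is_lub (tame_radii r L i y) v"
  proof (cases "y \<in> chart_dom X i")
    case True
    have "def_pred M (\<lambda>e. e 0 0 \<in> tame_radii r L i (pt i (chart X i y)))"
      by (intro def_pred_tame_radii def_term_var def_term_const i)
    then have "def_pred M (\<lambda>e. e 0 0 \<in> tame_radii r L i y)"
      by (simp only: pt_chart[OF i True])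
    moreover have "0 \<in> tame_radii r L i y" by (simp add: tame_radii_def)
    moreover have "s \<le> r" if "s \<in> tame_radii r L i y" for s
      using that r by (auto simp: tame_radii_def)
    ultimately show ?thesis by (rule ex_is_lub[OF dc])
  next
    case False
    then have "is_lub (tame_radii r L i y) 0" by (auto simp: is_lub_def tame_radii_def tame_def)
    then show ?thesis ..
  qed
  then show ?thesis unfolding tame_radius_def using is_lub_unique theI by metis
qed

lemma tame_radius_nonneg: "i \<in> chart_idx X \<Longrightarrow> 0 \<le> tame_radius r L i y"
  by (rule is_lubD[OF tame_radius_lub]) (simp_all add: tame_radii_def)

lemma tame_radius_le: "i \<in> chart_idx X \<Longrightarrow> tame_radius r L i y \<le> r"
  using r by (intro is_lub_least[OF tame_radius_lub]) (auto simp: tame_radii_def)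

lemma tame_radius_outside: "i \<in> chart_idx X \<Longrightarrow> y \<notin> chart_dom X i \<Longrightarrow> tame_radius r L i y = 0"
  by (intro order_antisym is_lub_least[OF tame_radius_lub] tame_radius_nonneg)
    (auto simp: tame_radii_def tame_def)

lemma tame_radius_eq: "i \<in> chart_idx X \<Longrightarrow> tame i y r (L - r) \<Longrightarrow> tame_radius r L i y = r"
  by (intro order_antisym tame_radius_le is_lubD[OF tame_radius_lub]) (auto simp: tame_radii_def)

lemma tame_if_less_radius:
  assumes i: "i \<in> chart_idx X" and \<delta>: "0 \<le> \<delta>" "\<delta> < tame_radius r L i y"
  shows "tame i y \<delta> (L - \<delta>)"
proof -
  obtain s where s: "s \<in> tame_radii r L i y" "\<delta> < s"
    using is_lub_least[OF tame_radius_lub[OF i], of y \<delta>] \<delta>(2) by (meson not_le)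
  then have t: "tame i y s (L - s)" using \<delta>(1) by (auto simp: tame_radii_def)
  show ?thesis
    by (rule tame_mono[OF i t, of _ 0]) (use t s(2) in \<open>simp_all add: tame_def wclose_refl diff_left_mono\<close>)
qed

text \<open>If \<open>s\<close> is admissible at \<open>y\<close>, then \<open>s - d\<close> is
  admissible at \<open>y'\<close>: the triangle inequality raises the coordinate bound by
  \<open>d\<close>, exactly the step from \<open>L - s\<close> to \<open>L - (s - d)\<close>. For
  \<open>s \<le> d\<close> the number \<open>s - d\<close> is nonpositive and admissible
  anyway.\<close>

lemma tame_radius_Lipschitz:
  assumes i: "i \<in> chart_idx X" and y: "y' \<in> chart_dom X i" and d: "0 \<le> d"
    and cl: "\<And>k. k < chart_dim X i \<Longrightarrow> wclose d (crd i y k) (crd i y' k)"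
  shows "tame_radius r L i y \<le> tame_radius r L i y' + d"
proof (rule is_lub_least[OF tame_radius_lub[OF i]])
  fix s assume s: "s \<in> tame_radii r L i y"
  have "s - d \<in> tame_radii r L i y'"
  proof (cases "s \<le> d")
    case False
    then have "\<not> s \<le> 0" using d by (meson order_trans)
    then have t: "s \<le> r" "tame i y s (L - s)" using s by (auto simp: tame_radii_def)
    have "tame i y' (s - d) (L - (s - d))"
      by (rule tame_mono[OF i t(2) y cl]) (simp_all add: algebra_simps)
    moreover have "s - d \<le> r" using t(1) d by (meson diff_le_self le_diff_eq order_trans add_increasing2 diff_le_eq)
    ultimately show ?thesis by (simp add: tame_radii_def)
  qed (simp add: tame_radii_def)
  then have "s - d \<le> tame_radius r L i y'" by (rule is_lubD[OF tame_radius_lub[OF i]])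
  then show "s \<le> tame_radius r L i y' + d" by (simp add: diff_le_eq)
qed

lemma tame_radius_continuous:
  assumes i: "i \<in> chart_idx X" and z: "z \<in> pts" and \<epsilon>: "0 < \<epsilon>"
  shows "\<exists>V. openin (space_top X) V \<and> z \<in> V \<and> (\<forall>y\<in>V. close \<epsilon> (tame_radius r L i z) (tame_radius r L i y))"
proof -
  obtain d where d: "d > 0" "d + d = \<epsilon>" using half[OF \<epsilon>] by blast
  have "d < \<epsilon>" using d by (metis less_add_same_cancel1)
  show ?thesis
  proof (cases "z \<in> chart_dom X i")
    case True
    have "close \<epsilon> (tame_radius r L i z) (tame_radius r L i y)" if y: "y \<in> chart_ball i z d" for y
    proof -
      have cl: "wclose d (crd i z k) (crd i y k)" "wclose d (crd i y k) (crd i z k)" if "k < chart_dim X i" for k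
        using y that by (simp_all add: chart_ball_def close_wclose wclose_sym[of d "crd i y k"])
      have yU: "y \<in> chart_dom X i" using y by (simp add: chart_ball_def)
      have "wclose d (tame_radius r L i z) (tame_radius r L i y)"
        unfolding wclose_def
        using tame_radius_Lipschitz[OF i yU less_imp_le[OF d(1)] cl(1)]
          tame_radius_Lipschitz[OF i True less_imp_le[OF d(1)] cl(2)] by blast
      then show ?thesis using \<open>d < \<epsilon>\<close> by (rule wclose_close)
    qed
    then show ?thesis using open_chart_ball[OF i] chart_ball_self[OF True d(1)] by blast
  next
    case False
    obtain j where j: "j \<in> chart_idx X" "z \<in> chart_dom X j" using ex_chart[OF z] by blast
    \<comment> \<open>By contraposition of \<open>tame_closure\<close>, some neighbourhood of
      \<open>z\<close> has no point tame with radius \<open>d\<close>, so the radius is at most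
      \<open>d\<close> there.\<close>
    have "\<not> (\<forall>u>0. \<exists>y\<in>chart_ball j z u. tame i y d (L - d))"
      using tame_closure[OF dc i j d(1)] False by blast
    then obtain u where u: "0 < u" "\<And>y. y \<in> chart_ball j z u \<Longrightarrow> \<not> tame i y d (L - d)" by blast
    have "close \<epsilon> (tame_radius r L i z) (tame_radius r L i y)" if y: "y \<in> chart_ball j z u" for y
    proof -
      have "tame_radius r L i y \<le> d"
        using tame_if_less_radius[OF i] d(1) u(2)[OF y] by (meson not_le less_imp_le)
      then have "tame_radius r L i y < \<epsilon>" using \<open>d < \<epsilon>\<close> by (rule le_less_trans)
      then show ?thesis
        using tame_radius_nonneg[OF i, of y] \<epsilon>
        by (simp add: close_def tame_radius_outside[OF i False] add_nonneg_pos)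
    qed
    then show ?thesis using open_chart_ball[OF j(1)] chart_ball_self[OF j(2) u(1)] by blast
  qed
qed

lemma def_term_tame_radius:
  assumes i: "i \<in> chart_idx X" and j: "j \<in> chart_idx X"
  shows "def_term M (\<lambda>e. tame_radius r L i (pt j (e 0)))"
proof -
  \<comment> \<open>This trades the definite description for a first-order condition.\<close>
  have "v = tame_radius r L i y \<longleftrightarrow> is_lub (tame_radii r L i y) v" for v y
    using tame_radius_lub[OF i] is_lub_unique by metis
  then show ?thesis
    unfolding def_term_def is_lub_def
    by (simp, intro def_pred_conj def_pred_all def_pred_imp def_pred_tame_radii def_pred_le def_term_var i j)
qed

end

end

section \<open>The embedding\<close>

context
  fixes e :: "'a::linordered_ab_group_add" and m :: "'a \<Rightarrow> 'a \<Rightarrow> 'a"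
  assumes ofm: "ordered_field_mult e m"
begin

lemma ordered_field_mult_laws:
  "m (m x y) z = m x (m y z)" "m x y = m y x" "m e x = x" "m x (y + z) = m x y + m x z" "e \<noteq> 0"
  "x \<noteq> 0 \<Longrightarrow> \<exists>y. m x y = e"
proof -
  interpret F: field "\<lparr>carrier = UNIV, monoid.mult = m, one = e, zero = 0, add = (+)\<rparr>"
    using ofm by (simp add: ordered_field_mult_def)
  show "m (m x y) z = m x (m y z)" using F.m_assoc[of x y z] by simp
  show "m x y = m y x" using F.m_comm[of x y] by simp
  show "m e x = x" using F.l_one[of x] by simp
  show "m x (y + z) = m x y + m x z" using F.r_distr[of y z x] by simp
  show "e \<noteq> 0" using F.one_not_zero by simp
  show "\<exists>y. m x y = e" if "x \<noteq> 0" using F.field_Units that by (auto simp: Units_def)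
qed

lemma ordered_field_mult_zero: "m x 0 = 0"
  using ordered_field_mult_laws(4)[of x 0 0] by simp

lemma ordered_field_mult_minus: "m x (- y) = - m x y"
  using ordered_field_mult_laws(4)[of x y "- y"]
  by (simp add: ordered_field_mult_zero eq_neg_iff_add_eq_0 add.commute)

lemma ordered_field_mult_pos: "0 < x \<Longrightarrow> 0 < y \<Longrightarrow> 0 < m x y"
  using ofm by (simp add: ordered_field_mult_def)

lemma ordered_field_mult_pos_cancel:
  assumes "0 < x" "0 < m x y" shows "0 < y"
proof (rule ccontr)
  assume "\<not> 0 < y"
  then consider "y = 0" | "0 < - y" by (metis neg_0_less_iff_less not_less_iff_gr_or_eq)
  then show False
    using assms ordered_field_mult_pos[OF assms(1), of "- y"]
    by cases (auto simp: ordered_field_mult_zero ordered_field_mult_minus)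
qed

lemma ordered_field_one_pos: "0 < e"
proof (rule ccontr)
  assume "\<not> 0 < e"
  then have "0 < - e" using ordered_field_mult_laws(5) by (metis neg_0_less_iff_less not_less_iff_gr_or_eq)
  moreover have "m (- e) (- e) = e"
    using ordered_field_mult_laws(2,3) ordered_field_mult_minus by (metis minus_minus)
  ultimately show False using ordered_field_mult_pos[of "- e" "- e"] \<open>\<not> 0 < e\<close> by simp
qed

lemma ordered_field_half:
  fixes s :: 'a
  assumes "0 < s" shows "\<exists>t>0. t + t = s"
proof -
  have "e + e \<noteq> 0" using ordered_field_one_pos add_pos_pos[of e e] by auto
  then obtain y where y: "m (e + e) y = e" using ordered_field_mult_laws(6) by blast
  have "m s y + m s y = m s (m (e + e) y)"
    using ordered_field_mult_laws(2,3,4) by metis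
  then have t: "m s y + m s y = s" using y ordered_field_mult_laws(2,3) by metis
  have "0 < m s y"
  proof (rule ccontr)
    assume "\<not> 0 < m s y"
    then have "m s y + m s y \<le> 0" by (simp add: add_nonpos_nonpos)
    then show False using t assms by simp
  qed
  then show ?thesis using t by blast
qed

end

text \<open>The map \<open>g\<close> is multiplication by \<open>B / r\<close>, whose definability is only known on \<open>[0, r]\<close>.\<close>

lemma ex_definable_scaling:
  fixes M :: "('f, 'r, 'a::{linordered_ab_group_add, linorder_topology}) expansion"
  assumes M: "has_definable_bounded_mult M" and r: "0 < r" and B: "0 < B"
  shows "\<exists>g. (\<forall>x y. g (x + y) = g x + g y) \<and> strict_mono g \<and> surj g \<and> g r = B \<and>
    (\<forall>f. def_term M f \<longrightarrow> (\<forall>e. 0 \<le> f e \<and> f e \<le> r) \<longrightarrow> def_term M (\<lambda>e. g (f e)))"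
proof -
  obtain e m where ofm: "ordered_field_mult e m" and
    dm: "\<And>a b. a < b \<Longrightarrow> definable M 3 {x \<in> Mpow 3. x 0 \<in> {a<..<b} \<and> x 1 \<in> {a<..<b} \<and> x 2 = m (x 0) (x 1)}"
    using M unfolding has_definable_bounded_mult_def by blast
  note laws = ordered_field_mult_laws[OF ofm]
  obtain y where y: "m r y = e" using laws(6)[of r] r by auto
  \<comment> \<open>\<open>y\<close> is the inverse of \<open>r\<close>, so \<open>c\<close> is
    \<open>B / r\<close>.\<close>
  define c where "c = m B y"
  have cr: "m c r = B" unfolding c_def laws(1) laws(2)[of y r] y laws(2)[of B e] by (rule laws(3))
  have c: "0 < c"
    by (rule ordered_field_mult_pos_cancel[OF ofm r]) (simp add: laws(2)[of r c] cr B)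
  then obtain d where d: "m c d = e" using laws(6)[of c] by auto
  have "strict_mono (m c)"
  proof (rule strict_monoI)
    fix x x' :: 'a assume "x < x'"
    then have "0 < m c (x' - x)" using ordered_field_mult_pos[OF ofm c] by simp
    also have "m c (x' - x) = m c x' - m c x"
      using laws(4)[of c x' "- x"] ordered_field_mult_minus[OF ofm] by simp
    finally show "m c x < m c x'" by simp
  qed
  moreover have "surj (m c)"
    by (rule surjI[of _ "\<lambda>x. m d x"]) (simp add: laws(1)[symmetric] d laws(3))
  moreover have "def_term M (\<lambda>e. m c (f e))" if f: "def_term M f" "\<And>e. 0 \<le> f e \<and> f e \<le> r" for f
  proof -
    \<comment> \<open>The interval from \<open>- b\<close> to \<open>b\<close> contains both
      factors, \<open>c\<close> and every value of \<open>f\<close>, so the definable restriction of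
      \<open>m\<close> computes the product.\<close>
    define b where "b = r + c"
    have b: "0 < b" "r < b" "c < b" using r c by (simp_all add: b_def add_pos_pos)
    have "- b < b" using b(1) by (metis neg_less_0_iff_less less_trans)
    then have A: "definable M 3 {x \<in> Mpow 3. x 0 \<in> {- b<..<b} \<and> x 1 \<in> {- b<..<b} \<and> x 2 = m (x 0) (x 1)}"
      (is "definable M 3 ?A") by (rule dm)
    let ?F = "\<lambda>e k. if k = 0 then c else if k = 1 then f (\<lambda>i. e (Suc i)) else e 0 0"
    have "def_term M (\<lambda>e. ?F e k)" for k :: nat
      using def_term_shift[OF f(1)] by (cases "k = 0"; cases "k = 1") (simp_all add: def_term_const def_term_var)
    then have "def_pred M (\<lambda>e. restrict (?F e) {..<3} \<in> ?A)" by (rule def_pred_mem[OF A])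
    moreover have "restrict (?F e) {..<3} \<in> ?A \<longleftrightarrow> e 0 0 = m c (f (\<lambda>i. e (Suc i)))" for e
    proof -
      have 1: "- b < c" "c < b" using b c by (auto intro: less_trans[of _ 0])
      have 2: "- b < f (\<lambda>i. e (Suc i))" "f (\<lambda>i. e (Suc i)) < b"
        using b f(2)[of "\<lambda>i. e (Suc i)"] by (auto intro: less_le_trans[of _ 0] le_less_trans)
      show ?thesis using 1 2 by (simp add: Mpow_def)
    qed
    ultimately show ?thesis unfolding def_term_def by simp
  qed
  ultimately have "(\<forall>x y. m c (x + y) = m c x + m c y) \<and> strict_mono (m c) \<and> surj (m c) \<and> m c r = B \<and>
    (\<forall>f. def_term M f \<longrightarrow> (\<forall>e. 0 \<le> f e \<and> f e \<le> r) \<longrightarrow> def_term M (\<lambda>e. m c (f e)))"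
    using laws(4) cr by simp
  then show ?thesis by (rule exI[of _ "m c"])
qed

section \<open>Clamping, and criteria for continuity and embeddings\<close>

lemma clamp_id:
  fixes a c :: "'a::linordered_ab_group_add"
  shows "- c \<le> a \<Longrightarrow> a \<le> c \<Longrightarrow> max (- c) (min c a) = a"
  by (simp add: min_absorb2 max_absorb2)

text \<open>A value strictly inside a smaller symmetric interval cannot be one of the clamping
  bounds, so clamping did nothing.\<close>

lemma clamp_eq_if_less:
  fixes a b c :: "'a::linordered_ab_group_add"
  assumes "b < c" "- b < max (- c) (min c a)" "max (- c) (min c a) < b"
  shows "max (- c) (min c a) = a"
proof -
  have "- c < - b" using assms(1) by simp
  then show ?thesis using assms by (auto simp: max_def min_def split: if_splits)
qed

lemma continuous_map_euclidean_close:
  fixes f :: "'s \<Rightarrow> 'a::{linordered_ab_group_add, linorder_topology}"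
  assumes "0 < (a::'a)"
    and "\<And>z \<epsilon>. z \<in> topspace T \<Longrightarrow> 0 < \<epsilon> \<Longrightarrow>
      \<exists>V. openin T V \<and> z \<in> V \<and> (\<forall>y\<in>V. close \<epsilon> (f z) (f y))"
  shows "continuous_map T euclidean f"
  unfolding continuous_map_def
proof (intro conjI allI impI)
  fix S :: "'a set" assume "openin euclidean S"
  then have S: "open S" by simp
  show "openin T {x \<in> topspace T. f x \<in> S}"
  proof (subst openin_subopen, intro ballI)
    fix z assume "z \<in> {x \<in> topspace T. f x \<in> S}"
    then have z: "z \<in> topspace T" "f z \<in> S" by auto
    obtain \<epsilon> where \<epsilon>: "\<epsilon> > 0" "\<And>b. close \<epsilon> (f z) b \<Longrightarrow> b \<in> S"
      using open_contains_close[OF S z(2) assms(1)] by blast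
    obtain V where V: "openin T V" "z \<in> V" "\<forall>y\<in>V. close \<epsilon> (f z) (f y)"
      using assms(2)[OF z(1) \<epsilon>(1)] by blast
    then show "\<exists>V. openin T V \<and> z \<in> V \<and> V \<subseteq> {x \<in> topspace T. f x \<in> S}"
      using \<epsilon>(2) openin_subset[OF V(1)] by blast
  qed
qed simp

text \<open>\<open>initial\<close> pulls neighbourhoods back from the codomain, which gives openness
  onto the image one point at a time.\<close>

lemma embedding_map_if_initial:
  assumes cont: "continuous_map T Y h" and inj: "inj_on h (topspace T)"
    and initial: "\<And>x V. x \<in> V \<Longrightarrow> openin T V \<Longrightarrow>
      \<exists>W. openin Y W \<and> h x \<in> W \<and> (\<forall>y\<in>topspace T. h y \<in> W \<longrightarrow> y \<in> V)"
  shows "embedding_map T Y h"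
proof -
  have "open_map T (subtopology Y (h ` topspace T)) h"
    unfolding open_map_def
  proof (intro allI impI)
    fix V assume V: "openin T V"
    show "openin (subtopology Y (h ` topspace T)) (h ` V)"
    proof (subst openin_subopen, intro ballI)
      fix p assume "p \<in> h ` V"
      then obtain x where x: "x \<in> V" "p = h x" by blast
      obtain W where W: "openin Y W" "h x \<in> W" "\<forall>y\<in>topspace T. h y \<in> W \<longrightarrow> y \<in> V"
        using initial[OF x(1) V] by blast
      have "openin (subtopology Y (h ` topspace T)) (W \<inter> h ` topspace T)"
        using W(1) by (auto simp: openin_subtopology)
      moreover have "p \<in> W \<inter> h ` topspace T" using W(2) x openin_subset[OF V] by blast
      moreover have "W \<inter> h ` topspace T \<subseteq> h ` V" using W(3) by blast
      ultimately show "\<exists>S. openin (subtopology Y (h ` topspace T)) S \<and> p \<in> S \<and> S \<subseteq> h ` V" by blast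
    qed
  qed
  moreover have "continuous_map T (subtopology Y (h ` topspace T)) h"
    using cont by (simp add: continuous_map_in_subtopology)
  moreover have "topspace (subtopology Y (h ` topspace T)) = h ` topspace T"
    using continuous_map_image_subset_topspace[OF cont] by auto
  ultimately show ?thesis
    unfolding embedding_map_def using inj by (simp add: bijective_open_imp_homeomorphic_map)
qed

context pd_space
begin

text \<open>Shrinking the radius forces equal coordinates, and charts are injective. Injectivity of
  the embedding is obtained from its neighbourhood property in this way.\<close>

lemma chart_ball_all_radii:
  assumes i: "i \<in> chart_idx X" and x: "x \<in> chart_dom X i" and y: "\<And>u. 0 < u \<Longrightarrow> y \<in> chart_ball i x u"
  shows "x = y"
proof -
  obtain e :: 'a where "0 < e" using ex_pos by blast
  then have yU: "y \<in> chart_dom X i" using y by (auto simp: chart_ball_def)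
  have "chart X i x k = chart X i y k" if k: "k < chart_dim X i" for k
  proof -
    have "wclose 0 (crd i x k) (crd i y k)"
      using y k by (intro wclose_limit exI[of _ "crd i x k"]) (auto simp: chart_ball_def wclose_refl)
    then show ?thesis using x yU k by (simp add: wclose_def crd_def order_antisym)
  qed
  then have "chart X i x = chart X i y"
    using chart_Mpow[OF i x] chart_Mpow[OF i yU] unfolding Mpow_def
    by (intro extensionalityI[of _ "{..<chart_dim X i}"]) (auto simp: PiE_def)
  then show ?thesis using inj_onD[OF inj_chart[OF i]] x yU by blast
qed

lemma definable_map_if_def_terms:
  assumes H: "\<And>i n. i \<in> chart_idx X \<Longrightarrow> n < N \<Longrightarrow> def_term M (\<lambda>e. H n (pt i (e 0)))"
  shows "definable_map M X (Mpow_space N) (\<lambda>y. \<lambda>n\<in>{..<N}. H n y)"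
proof -
  let ?h = "\<lambda>y. \<lambda>n\<in>{..<N}. H n y"
  have h_Mpow: "?h y \<in> Mpow N" for y by (simp add: Mpow_def)
  show ?thesis
    unfolding definable_map_def definable_in_def
  proof (intro conjI ballI)
    show "?h \<in> pts \<rightarrow> topspace (space_top (Mpow_space N))"
      using h_Mpow by (simp add: Mpow_space_def topspace_Mpow_top)
    show "(\<lambda>x. (x, ?h x)) ` pts \<subseteq> topspace (space_top (prod_space X (Mpow_space N)))"
      using h_Mpow by (auto simp: Mpow_space_def prod_space_def topspace_Mpow_top)
    fix p assume "p \<in> chart_idx (prod_space X (Mpow_space N :: (nat \<Rightarrow> 'a, unit, 'a) atlas_space))"
    then obtain i where p: "p = (i, ())" and i: "i \<in> chart_idx X"
      by (auto simp: prod_space_def Mpow_space_def)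
    let ?m = "chart_dim X i"
    let ?Q = "\<lambda>y. restrict y {..<?m} \<in> chart X i ` chart_dom X i \<and> (\<forall>n<N. y (?m + n) = H n (pt i y))"
    have img: "chart (prod_space X (Mpow_space N)) p `
        ((\<lambda>x. (x, ?h x)) ` pts \<inter> chart_dom (prod_space X (Mpow_space N)) p)
        = (\<lambda>x. concat_pt ?m N (chart X i x) (?h x)) ` chart_dom X i" (is "?L = _")
    proof -
      have "(\<lambda>x. (x, ?h x)) ` pts \<inter> chart_dom X i \<times> Mpow N = (\<lambda>x. (x, ?h x)) ` chart_dom X i"
        using dom_pts[OF i] h_Mpow by blast
      then show ?thesis by (simp add: p prod_space_def Mpow_space_def image_image)
    qed
    also have "\<dots> = {y \<in> Mpow (?m + N). ?Q y}" (is "?L' = ?R")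
    proof (intro equalityI subsetI)
      fix y assume "y \<in> ?L'"
      then obtain x where x: "x \<in> chart_dom X i" "y = concat_pt ?m N (chart X i x) (?h x)" by blast
      have "restrict y {..<?m} = chart X i x" using chart_Mpow[OF i x(1)] unfolding x(2)
        by (intro ext) (auto simp: concat_pt_def Mpow_def PiE_iff extensional_def)
      moreover from this have "pt i y = x" using pt_chart[OF i x(1)] pt_restrict by metis
      moreover have "y \<in> Mpow (?m + N)" unfolding x(2) by (simp add: concat_pt_def Mpow_def)
      ultimately show "y \<in> ?R" using x by (simp add: concat_pt_def)
    next
      fix y assume y: "y \<in> ?R"
      then obtain x where x: "x \<in> chart_dom X i" "restrict y {..<?m} = chart X i x" by auto
      then have "pt i y = x" using pt_chart[OF i x(1)] pt_restrict by metis
      then have "y = concat_pt ?m N (chart X i x) (?h x)"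
        using y unfolding x(2)[symmetric]
        by (intro ext) (auto simp: concat_pt_def Mpow_def PiE_iff extensional_def dest: spec[of _ "_ - ?m"])
      then show "y \<in> ?L'" using x(1) by blast
    qed
    finally have eq: "?L = ?R" .
    have "def_pred M (\<lambda>e. ?Q (e 0))"
      by (intro def_pred_conj def_pred_in_codom def_pred_all_less def_pred_eq def_term_var H i)
    moreover have "?Q (restrict y {..<?m + N}) \<longleftrightarrow> ?Q y" for y
    proof -
      have *: "restrict (restrict y {..<?m + N}) {..<?m} = restrict y {..<?m}" by auto
      moreover have "pt i (restrict y {..<?m + N}) = pt i y" using * pt_restrict by metis
      ultimately show ?thesis by simp
    qed
    ultimately have "definable M (?m + N) ?R" by (intro definable_if_def_pred) simp
    then show "definable M (chart_dim (prod_space X (Mpow_space N)) p)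
       (chart (prod_space X (Mpow_space N)) p `
         ((\<lambda>x. (x, ?h x)) ` pts \<inter> chart_dom (prod_space X (Mpow_space N)) p))"
      unfolding eq by (simp add: p prod_space_def Mpow_space_def)
  qed
qed

lemma ex_definable_embedding:
  assumes dc: "definably_complete M" and mult: "has_definable_bounded_mult M"
    and reg: "regular_space (space_top X)" and compact: "definably_compact M X"
  shows "\<exists>n h. definable_map M X (Mpow_space n) h \<and> embedding_map (space_top X) (Mpow_top n) h"
proof -
  obtain r K where r: "0 < r" and K: "0 < K" and cover: "\<And>x. x \<in> pts \<Longrightarrow> \<exists>i\<in>chart_idx X. tame i x r K"
    using uniformly_tame[OF reg compact] by blast
  define B where "B = K + K + K"
  have B: "0 < B" "K + K < B" "K < K + K" using K by (simp_all add: B_def add_pos_pos)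
  have KB: "K \<le> B" using B by (meson less_trans less_imp_le)
  obtain g where g_add: "\<And>x y. g (x + y) = g x + g y" and g_mono: "strict_mono g" and g_surj: "surj g"
    and g_r: "g r = B"
    and g_def: "\<And>f. def_term M f \<Longrightarrow> \<forall>e. 0 \<le> f e \<and> f e \<le> r \<Longrightarrow> def_term M (\<lambda>e. g (f e))"
    using ex_definable_scaling[OF mult r B(1)] by blast
  have g0: "g 0 = 0" using g_add[of 0 0] by simp
  \<comment> \<open>With \<open>L = K + r\<close> the coordinate bound allowed at radius
    \<open>r\<close> is exactly \<open>K\<close>, so the points in \<open>cover\<close> attain the
    full radius and \<open>\<mu> i\<close> equals \<open>B\<close> there.\<close>
  define \<mu> where "\<mu> i y = g (tame_radius r (K + r) i y)" for i y
  define f where "f i k y = max (- \<mu> i y) (min (\<mu> i y) (crd i y k))" for i k y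
  \<comment> \<open>Index \<open>(i, 0)\<close> is the scaled radius and \<open>(i, Suc k)\<close>
    the clamped coordinate \<open>k\<close>; hence \<open>J\<close> runs up to
    \<open>chart_dim X i\<close> inclusive.\<close>
  define H where "H p = (case p of (i, n) \<Rightarrow> case n of 0 \<Rightarrow> \<mu> i | Suc k \<Rightarrow> f i k)" for p
  define J where "J = (SIGMA i:chart_idx X. {..chart_dim X i})"
  have "finite J" unfolding J_def using fin_idx by simp
  then obtain q where q: "bij_betw q {0..<card J} J" using ex_bij_betw_nat_finite by blast
  define N where "N = card J"
  have q_img: "q ` {..<N} = J" using q by (simp add: bij_betw_def N_def lessThan_atLeast0)
  define h where "h = (\<lambda>y. \<lambda>n\<in>{..<N}. H (q n) y)"
  have \<mu>_nonneg: "0 \<le> \<mu> i y" if "i \<in> chart_idx X" for i y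
    using tame_radius_nonneg[OF dc r that] g_mono g0 unfolding \<mu>_def by (metis strict_mono_less_eq)
  have \<mu>_outside: "\<mu> i y = 0" if "i \<in> chart_idx X" "y \<notin> chart_dom X i" for i y
    using tame_radius_outside[OF dc r that] g0 by (simp add: \<mu>_def)
  have \<mu>_cont: "\<exists>V. openin (space_top X) V \<and> z \<in> V \<and> (\<forall>y\<in>V. close \<epsilon> (\<mu> i z) (\<mu> i y))"
    if i: "i \<in> chart_idx X" and z: "z \<in> pts" and \<epsilon>: "0 < \<epsilon>" for i z \<epsilon>
  proof -
    \<comment> \<open>Additivity and monotonicity of \<open>g\<close> turn tolerance
      \<open>\<delta>\<close> into \<open>g \<delta>\<close>; surjectivity provides a
      \<open>\<delta>\<close> for the given \<open>\<epsilon>\<close>.\<close>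
    obtain \<delta> where \<delta>: "g \<delta> = \<epsilon>" using g_surj by (metis surjD)
    then have "0 < \<delta>" using \<epsilon> g0 g_mono by (metis strict_mono_less)
    moreover have "close \<epsilon> (g a) (g b)" if "close \<delta> a b" for a b
      using that g_mono unfolding close_def \<delta>[symmetric] g_add[symmetric] by (simp add: strict_mono_less)
    ultimately show ?thesis unfolding \<mu>_def using tame_radius_continuous[OF dc r i z] by meson
  qed
  have H_cont: "\<exists>V. openin (space_top X) V \<and> z \<in> V \<and> (\<forall>y\<in>V. close \<epsilon> (H p z) (H p y))"
    if p: "p \<in> J" and z: "z \<in> pts" and \<epsilon>: "0 < \<epsilon>" for p z \<epsilon>
  proof -
    obtain i n where pn: "p = (i, n)" and i: "i \<in> chart_idx X" and n: "n \<le> chart_dim X i"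
      using p by (auto simp: J_def)
    show ?thesis
    proof (cases n)
      case 0
      then show ?thesis using \<mu>_cont[OF i z \<epsilon>] by (simp add: H_def pn)
    next
      case (Suc k)
      then have k: "k < chart_dim X i" using n by simp
      obtain V where V: "openin (space_top X) V" "z \<in> V" "\<And>y. y \<in> V \<Longrightarrow> close \<epsilon> (\<mu> i z) (\<mu> i y)"
        using \<mu>_cont[OF i z \<epsilon>] by blast
      have "\<exists>V. openin (space_top X) V \<and> z \<in> V \<and> (\<forall>y\<in>V. close \<epsilon> (f i k z) (f i k y))"
      proof (cases "z \<in> chart_dom X i")
        case True
        have "close \<epsilon> (f i k z) (f i k y)" if "y \<in> V \<inter> chart_ball i z \<epsilon>" for y
          unfolding f_def using that V(3) k by (intro close_clamp) (auto simp: chart_ball_def)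
        moreover have "openin (space_top X) (V \<inter> chart_ball i z \<epsilon>)"
          using V(1) open_chart_ball[OF i] by blast
        ultimately show ?thesis using V(2) chart_ball_self[OF True \<epsilon>] by blast
      next
        case False
        then have z0: "\<mu> i z = 0" "f i k z = 0" using \<mu>_outside[OF i] by (simp_all add: f_def crd_def)
        \<comment> \<open>At a point outside the chart, the coordinates of nearby points are
          uncontrolled; continuity comes from the clamping bound alone, which is 0 at
          \<open>z\<close> and small on \<open>V\<close>.\<close>
        have "close \<epsilon> (f i k z) (f i k y)" if "y \<in> V" for y
          unfolding z0(2) close_sym[of \<epsilon> 0] unfolding f_def
          by (rule close_clamp_zero) (use V(3)[OF that] z0(1) \<mu>_nonneg[OF i] in \<open>simp_all add: close_sym[of \<epsilon> 0]\<close>)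
        then show ?thesis using V by blast
      qed
      then show ?thesis by (simp add: H_def pn Suc)
    qed
  qed
  have "definable_map M X (Mpow_space N) h"
    unfolding h_def
  proof (rule definable_map_if_def_terms)
    fix j n assume j: "j \<in> chart_idx X" and "n < N"
    then have "q n \<in> J" using q_img by blast
    then obtain i l where pn: "q n = (i, l)" and i: "i \<in> chart_idx X" by (auto simp: J_def)
    have "def_term M (\<lambda>e. \<mu> i (pt j (e 0)))"
      unfolding \<mu>_def using tame_radius_nonneg[OF dc r i] tame_radius_le[OF dc r i]
      by (intro g_def def_term_tame_radius[OF dc r i j]) simp
    then show "def_term M (\<lambda>e. H (q n) (pt j (e 0)))"
      by (cases l) (auto simp: H_def pn f_def intro!: def_term_max def_term_min def_term_uminus
          def_term_crd def_term_var i j)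
  qed
  moreover have "embedding_map (space_top X) (Mpow_top N) h"
  proof (rule embedding_map_if_initial)
    obtain a :: 'a where a: "0 < a" using ex_pos by blast
    show "continuous_map (space_top X) (Mpow_top N) h"
      unfolding Mpow_top_def continuous_map_componentwise
    proof (intro conjI ballI)
      show "h ` pts \<subseteq> extensional {..<N}" by (auto simp: h_def)
      fix n assume n: "n \<in> {..<N}"
      then have "q n \<in> J" using q_img by blast
      then have "continuous_map (space_top X) euclidean (H (q n))"
        using H_cont by (intro continuous_map_euclidean_close[OF a]) blast
      then show "continuous_map (space_top X) euclidean (\<lambda>x. h x n)"
        using n by (simp add: h_def)
    qed
    show initial: "\<exists>W. openin (Mpow_top N) W \<and> h x \<in> W \<and> (\<forall>y\<in>pts. h y \<in> W \<longrightarrow> y \<in> V)"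
      if xV: "x \<in> V" and V: "openin (space_top X) V" for x V
    proof -
      have "x \<in> pts" using xV openin_subset[OF V] by blast
      then obtain i where i: "i \<in> chart_idx X" and x: "tame i x r K" using cover by blast
      then have xU: "x \<in> chart_dom X i" by (simp add: tame_def)
      obtain s where s: "s > 0" "chart_ball i x s \<subseteq> V" using ex_chart_ball_subset[OF i xU xV V] by blast
      have \<mu>x: "\<mu> i x = B" using tame_radius_eq[OF dc r i, of x "K + r"] x g_r by (simp add: \<mu>_def)
      have bound: "crd i x k \<le> K" "- K \<le> crd i x k" if "k < chart_dim X i" for k
      proof -
        have *: "crd i x k \<le> 0 + K" "0 \<le> crd i x k + K"
          using x that unfolding tame_def wclose_def by blast+
        show "crd i x k \<le> K" using *(1) by simp
        show "- K \<le> crd i x k" using add_right_mono[OF *(2), of "- K"] by simp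
      qed
      have fx: "f i k x = crd i x k" if "k < chart_dim X i" for k
      proof -
        have "- B \<le> crd i x k" "crd i x k \<le> B"
          using bound[OF that] KB by (auto intro: order_trans[of _ "- K"])
        then show ?thesis unfolding f_def \<mu>x by (rule clamp_id)
      qed
      \<comment> \<open>Only components of chart \<open>i\<close> are constrained. The first forces
        \<open>y\<close> into the chart, since \<open>\<mu> i\<close> vanishes outside; together
        with the strict interval it shows that clamping was inactive at \<open>y\<close>, so
        closeness of clamped values is closeness of coordinates.\<close>
      define W where "W p = (case p of (j, n) \<Rightarrow> if j \<noteq> i then UNIV else
        (case n of 0 \<Rightarrow> {K + K<..} | Suc k \<Rightarrow> {- (K + K)<..<K + K} \<inter> {b. close s (crd i x k) b}))" for p
      have "open (W p)" for p
        by (auto simp: W_def open_close split: prod.split nat.split)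
      then have "openin (Mpow_top N) (PiE {..<N} (\<lambda>n. W (q n)))"
        unfolding Mpow_top_def by (subst openin_PiE_gen) simp
      moreover have "H p x \<in> W p" if p: "p \<in> J" for p
      proof -
        obtain j n where pn: "p = (j, n)" "n \<le> chart_dim X j" using p by (auto simp: J_def)
        show ?thesis
        proof (cases "j = i")
          case True
          show ?thesis
          proof (cases n)
            case 0
            then show ?thesis using B(2) \<mu>x by (simp add: W_def H_def pn True)
          next
            case (Suc k)
            then have k: "k < chart_dim X i" using pn True by simp
            have "- (K + K) < crd i x k" "crd i x k < K + K"
              using bound[OF k] B(3) by (auto intro: le_less_trans less_le_trans[of _ "- K"] simp del: minus_add_distrib)
            then show ?thesis using fx[OF k] close_refl[OF s(1)] by (simp add: W_def H_def pn Suc True)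
          qed
        qed (simp add: W_def pn)
      qed
      then have "H (q n) x \<in> W (q n)" if "n < N" for n using that q_img by blast
      then have "h x \<in> PiE {..<N} (\<lambda>n. W (q n))" by (simp add: h_def)
      moreover have "y \<in> V" if hy: "h y \<in> PiE {..<N} (\<lambda>n. W (q n))" for y
      proof -
        have HW: "H p y \<in> W p" if "p \<in> J" for p
        proof -
          obtain n where "n < N" "q n = p" using \<open>p \<in> J\<close> q_img by blast
          then show ?thesis using hy by (auto simp: h_def PiE_iff)
        qed
        have \<mu>y: "K + K < \<mu> i y" using HW[of "(i, 0)"] i by (simp add: J_def W_def H_def)
        have yU: "y \<in> chart_dom X i"
        proof (rule ccontr)
          assume "y \<notin> chart_dom X i"
          then have "K + K < 0" using \<mu>_outside[OF i] \<mu>y by simp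
          then show False using K by (metis add_pos_pos less_asym)
        qed
        have "close s (crd i x k) (crd i y k)" if k: "k < chart_dim X i" for k
        proof -
          have *: "- (K + K) < f i k y" "f i k y < K + K" "close s (crd i x k) (f i k y)"
            using HW[of "(i, Suc k)"] i k by (simp_all add: J_def W_def H_def)
          have "f i k y = crd i y k"
            unfolding f_def by (rule clamp_eq_if_less[OF \<mu>y]) (use *(1,2) in \<open>simp_all only: f_def\<close>)
          then show ?thesis using *(3) by simp
        qed
        then have "y \<in> chart_ball i x s" using yU by (simp add: chart_ball_def)
        then show ?thesis using s(2) by blast
      qed
      ultimately show ?thesis by blast
    qed
    show "inj_on h pts"
    proof (rule inj_onI)
      fix x y assume xy: "x \<in> pts" "y \<in> pts" "h x = h y"
      obtain i where i: "i \<in> chart_idx X" "x \<in> chart_dom X i" using ex_chart[OF xy(1)] by blast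
      \<comment> \<open>Since \<open>h y = h x\<close>, it lies in the open set that
        \<open>initial\<close> assigns to each ball around \<open>x\<close>.\<close>
      have "y \<in> chart_ball i x u" if "0 < u" for u
        using initial[OF chart_ball_self[OF i(2) that] open_chart_ball[OF i(1)]] xy by auto
      then show "x = y" by (rule chart_ball_all_radii[OF i])
    qed
  qed
  ultimately show ?thesis by blast
qed

end

theorem theorem5p11:
  fixes M :: "('f, 'r, 'a::{linordered_ab_group_add, linorder_topology}) expansion"
    and X :: "('s, 'i, 'a) atlas_space"
  assumes "definably_complete M"
    and "locally_o_minimal M"
    and "has_definable_bounded_mult M"
    and "pseudo_definable_space M X"
    and "regular_space (space_top X)"
    and "definably_compact M X"
  shows "\<exists>n h. definable_map M X (Mpow_space n) h \<and>
               embedding_map (space_top X) (Mpow_top n) h"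
proof -
  obtain e :: 'a and m where ofm: "ordered_field_mult e m"
    using assms(3) unfolding has_definable_bounded_mult_def by blast
  interpret pd_space M X
    using assms(4) ordered_field_half[OF ofm] ordered_field_one_pos[OF ofm] by unfold_locales blast+
  show ?thesis using assms by (intro ex_definable_embedding)
qed

end
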